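(* Let $v:B\setminus\{0\}\to\Gamma$ be a valuation over $K$ and let $f_1,\dots,f_k\in A$ be (non-zero) $\Delta$-homogeneous generators of $A$ as a $K$-algebra. If $\{f_1,\dots,f_k\}$ is a $\Delta$-homogeneous MUVAK basis of $A$ with respect to $v$, then $\{f_1,\dots,f_k\}$ is a $\Delta$-homogeneous Khovanskii basis of $A$ with respect to $v$. Conversely, if $\{f_1,\dots,f_k\}$ is a $\Delta$-homogeneous Khovanskii basis of $A$ with respect to $v$ and the homogeneous subduction algorithm terminates for $A$, then $\{f_1,\dots,f_k\}$ is a $\Delta$-homogeneous MUVAK basis of $A$ with respect to $v$.
   Context: $K$ is a field; $A\le B$ are finitely generated commutative $K$-algebras and domains ($A$ a $K$-subalgebra of $B$). $(\Gamma,+,\succeq)$ is a linearly ordered abelian group (total order with $\gamma_1\succeq\gamma_2\Rightarrow\gamma_1+\gamma_3\succeq\gamma_2+\gamma_3$). A valuation over $K$ is a map $v:B\setminus\{0\}\to\Gamma$ with $v(f+g)\succeq\min\{v(f),v(g)\}$ whenever $f,g,f+g\ne0$; $v(fg)=v(f)+v(g)$ for $f,g\neq 0$; $v(\lambda f)=v(f)$ for $0\ne\lambda\in K$, $f\neq0$. Convention: $v(0)=\infty$, larger than every element of $\Gamma$. For $\gamma\in\Gamma$ let $F_{v\succeq\gamma}=\{f\in B\setminus\{0\}\mid v(f)\succeq\gamma\}\cup\{0\}$, similarly $F_{v\succ\gamma}$, and $\operatorname{gr}_v(B)=\bigoplus_{\gamma\in\Gamma}F_{v\succeq\gamma}/F_{v\succ\gamma}$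 (associated graded algebra). For $0\ne f\in B$ with $v(f)=\gamma$, $\operatorname{in}_v(f)$ is the class of $f$ in $F_{v\succeq\gamma}/F_{v\succ\gamma}$. $A$ is graded by a finitely generated abelian group $\Delta$, with degree function $\deg_\Delta$. For $\Delta$-homogeneous $0\neq f\in A$ of degree $\delta$ put $\operatorname{in}_v^\Delta(f)=\operatorname{in}_v(f)\otimes\delta\in\operatorname{gr}_v(B)\otimes_KK\Delta$, where $K\Delta$ is the group ring. For $S\subseteq A$, $\operatorname{in}_v^\Delta(S)\le\operatorname{gr}_v(B)\otimes_KK\Delta$ is the $K$-subalgebra generated by all $\operatorname{in}_v^\Delta(f)$ with $0\ne f\in S$ $\Delta$-homogeneous. A set $\mathcal G\subseteq A$ of $\Delta$-homogeneous $K$-algebra generators of $A$ is a $\Delta$-homogeneous Khovanskii basis of $A$ with respect to $v$ if $\{\operatorname{in}_v^\Delta(f)\mid f\in\mathcal G\}$ generates $\operatorname{in}_v^\Delta(A)$ as a $K$-algebra. For a polynomial $h$, $\operatorname{Supp}(h)$ is the set of its non-zero terms. A $\Delta$-homogeneous $f\in A$ is faithfully representable in $\Delta$-homogeneous elements $f_1,\dots,f_k\in A$ with respect to valuations $v_1,\dots,v_m:B\setminus\{0\}\to\Gamma$ over $K$ if there is $h\in K[X_1,\dots,X_k]$ with $h(f_1,\dots,f_k)=f$ and $v_i(t(f_1,\dots,f_k))\succeq v_i(f)$ for all $t\in\operatorname{Supp}(h)$ and all $i\in\{1,\dots,m\}$. A set $\mathcal G\subseteq A$ of $\Delta$-homogeneous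 $K$-algebra generators of $A$ is a $\Delta$-homogeneous MUVAK basis of $A$ with respect to $v_1,\dots,v_m$ if for every $\Delta$-homogeneous $f\in A$ there are $f_1,\dots,f_k\in\mathcal G$ such that $f$ is faithfully representable in $f_1,\dots,f_k$ with respect to $v_1,\dots,v_m$. (In the claim, $m=1$ and $v_1=v$.) Homogeneous subduction algorithm (for $v$). Input: a $\Delta$-homogeneous $f\in A$ and a (possibly infinite) set $\mathcal G\subseteq A$ of (non-zero) $\Delta$-homogeneous elements. Polynomials live in $K[X_g\mid g\in\mathcal G]$. Initialize $\mathcal G'=\emptyset$, $h=0$, $r=f$. While $r\neq0$ and $\operatorname{in}_v^\Delta(r)\in\operatorname{in}_v^\Delta(\mathcal G)$: choose a finite subset $\{f_1,\dots,f_k\}\subseteq\mathcal G$ and a polynomial $h'\in K[X_{f_1},\dots,X_{f_k}]$ with $h'(\operatorname{in}_v^\Delta(f_1),\dots,\operatorname{in}_v^\Delta(f_k))=\operatorname{in}_v^\Delta(r)$ and with $v(t(f_1,\dots,f_k))\succeq v(r)$ and $\deg_\Delta(t(f_1,\dots,f_k))=\deg_\Delta(r)$ for every $t\in\operatorname{Supp}(h')$ (such a choice always exists; it is made by an arbitrary but fixed rule); then replace $\mathcal G'$ by $\mathcal G'\cup\{f_1,\dots,f_k\}$, $r$ by $r-h'(f_1,\dots,f_k)$, and $h$ by $h+h'$. When the loop ends, return $\mathcal G'$, $h$, $r$. The algorithm "terminates for $A$" if it terminates after finitely many steps for every $\Delta$-homogeneous $f\in A$ and every set $\mathcal G\subseteq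 A$ of $\Delta$-homogeneous elements. *)

theory Defs
  imports
    Complex_Main
    "HOL-Algebra.Module"
    "HOL-Algebra.QuotRing"
    "HOL-Library.Poly_Mapping"
    "HOL-Library.Extended"
    "HOL-Library.While_Combinator"
    "HOL-Computational_Algebra.Group_Closure"
begin

text \<open>
  The base field \<open>K\<close>, the domain \<open>B\<close>, the value group \<open>\<Gamma>\<close> and the grading group \<open>\<Delta>\<close>
  are the types \<open>'k\<close>, \<open>'b\<close>, \<open>'g\<close> and \<open>'d\<close>.  Algebras that depend on terms (such as the
  associated graded algebra of a valuation) are records of type \<^typ>\<open>('k, 'a) module\<close>
  with an explicit carrier, whose scalars range over the whole type \<open>'k\<close>.
\<close>

section \<open>Algebras over a field and subalgebras\<close>

locale K_algebra = vector_space scale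
  for scale :: "'k::field \<Rightarrow> 'b::comm_ring_1 \<Rightarrow> 'b" +
  assumes scale_mult_left: "scale c (x * y) = scale c x * y"

definition type_algebra :: "('k \<Rightarrow> 'a::comm_ring_1 \<Rightarrow> 'a) \<Rightarrow> ('k, 'a) module" where
  "type_algebra scale = \<lparr>carrier = UNIV, mult = (*), one = 1, zero = 0, add = (+), smult = scale\<rparr>"

definition subalg :: "('k, 'a, 'm) module_scheme \<Rightarrow> 'a set \<Rightarrow> bool" where
  "subalg R S \<longleftrightarrow> S \<subseteq> carrier R \<and> \<one>\<^bsub>R\<^esub> \<in> S
     \<and> (\<forall>x\<in>S. \<forall>y\<in>S. x \<oplus>\<^bsub>R\<^esub> y \<in> S \<and> x \<otimes>\<^bsub>R\<^esub> y \<in> S)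
     \<and> (\<forall>c. \<forall>x\<in>S. c \<odot>\<^bsub>R\<^esub> x \<in> S)"

definition generated_subalg :: "('k, 'a, 'm) module_scheme \<Rightarrow> 'a set \<Rightarrow> 'a set" where
  "generated_subalg R S = subalg R hull S"

definition finitely_generated_alg :: "('k, 'a, 'm) module_scheme \<Rightarrow> 'a set \<Rightarrow> bool" where
  "finitely_generated_alg R A \<longleftrightarrow> (\<exists>S. finite S \<and> generated_subalg R S = A)"

section \<open>Polynomials and their evaluation\<close>

type_synonym ('x, 'k) mpoly = "('x \<Rightarrow>\<^sub>0 nat) \<Rightarrow>\<^sub>0 'k"

definition indets :: "('x, 'k::zero) mpoly \<Rightarrow> 'x set" where
  "indets h = (\<Union>m\<in>Poly_Mapping.keys h. Poly_Mapping.keys m)"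

text \<open>The non-zero terms of \<open>h\<close> are indexed by the exponents \<open>m \<in> keys h\<close>.\<close>

definition eval_term ::
  "('k, 'a, 'm) module_scheme \<Rightarrow> ('x \<Rightarrow> 'a) \<Rightarrow> ('x, 'k::zero) mpoly \<Rightarrow> ('x \<Rightarrow>\<^sub>0 nat) \<Rightarrow> 'a" where
  "eval_term R a h m =
     Poly_Mapping.lookup h m \<odot>\<^bsub>R\<^esub> (\<Otimes>\<^bsub>R\<^esub>i\<in>Poly_Mapping.keys m. a i [^]\<^bsub>R\<^esub> Poly_Mapping.lookup m i)"

definition eval_poly ::
  "('k, 'a, 'm) module_scheme \<Rightarrow> ('x \<Rightarrow> 'a) \<Rightarrow> ('x, 'k::zero) mpoly \<Rightarrow> 'a" where
  "eval_poly R a h = (\<Oplus>\<^bsub>R\<^esub>m\<in>Poly_Mapping.keys h. eval_term R a h m)"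

section \<open>Tensor products of algebras\<close>

definition pm_scale :: "'k::mult_zero \<Rightarrow> ('a \<Rightarrow>\<^sub>0 'k) \<Rightarrow> ('a \<Rightarrow>\<^sub>0 'k)" where
  "pm_scale c p = Poly_Mapping.map ((*) c) p"

text \<open>
  \<open>R \<otimes> S\<close> is the free vector space on the pairs \<open>(r, s)\<close>, made into an algebra by
  \<open>(r, s) (r', s') = (r r', s s')\<close>, modulo the subspace (an ideal) spanned by the
  bilinearity relations.
\<close>

definition pair_algebra ::
  "('k::field, 'r, 'm) module_scheme \<Rightarrow> ('k, 's, 'n) module_scheme \<Rightarrow> ('k, ('r \<times> 's) \<Rightarrow>\<^sub>0 'k) module" where
  "pair_algebra R S =
    \<lparr>carrier = {p. Poly_Mapping.keys p \<subseteq> carrier R \<times> carrier S},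
     mult = (\<lambda>p q. \<Sum>(r, s)\<in>Poly_Mapping.keys p. \<Sum>(r', s')\<in>Poly_Mapping.keys q.
       Poly_Mapping.single (r \<otimes>\<^bsub>R\<^esub> r', s \<otimes>\<^bsub>S\<^esub> s')
         (Poly_Mapping.lookup p (r, s) * Poly_Mapping.lookup q (r', s'))),
     one = Poly_Mapping.single (\<one>\<^bsub>R\<^esub>, \<one>\<^bsub>S\<^esub>) 1,
     zero = 0,
     add = (+),
     smult = pm_scale\<rparr>"

definition bilinear_relations ::
  "('k::field, 'r, 'm) module_scheme \<Rightarrow> ('k, 's, 'n) module_scheme \<Rightarrow> (('r \<times> 's) \<Rightarrow>\<^sub>0 'k) set" where
  "bilinear_relations R S =
     {Poly_Mapping.single (r \<oplus>\<^bsub>R\<^esub> r', s) 1 - Poly_Mapping.single (r, s) 1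
        - Poly_Mapping.single (r', s) 1 | r r' s. r \<in> carrier R \<and> r' \<in> carrier R \<and> s \<in> carrier S}
   \<union> {Poly_Mapping.single (r, s \<oplus>\<^bsub>S\<^esub> s') 1 - Poly_Mapping.single (r, s) 1
        - Poly_Mapping.single (r, s') 1 | r s s'. r \<in> carrier R \<and> s \<in> carrier S \<and> s' \<in> carrier S}
   \<union> {Poly_Mapping.single (c \<odot>\<^bsub>R\<^esub> r, s) 1 - Poly_Mapping.single (r, s) c
        | c r s. r \<in> carrier R \<and> s \<in> carrier S}
   \<union> {Poly_Mapping.single (r, c \<odot>\<^bsub>S\<^esub> s) 1 - Poly_Mapping.single (r, s) c
        | c r s. r \<in> carrier R \<and> s \<in> carrier S}"

definition tensor_ideal ::
  "('k::field, 'r, 'm) module_scheme \<Rightarrow> ('k, 's, 'n) module_scheme \<Rightarrow> (('r \<times> 's) \<Rightarrow>\<^sub>0 'k) set" where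
  "tensor_ideal R S = Modules.module.span pm_scale (bilinear_relations R S)"

definition tensor_algebra ::
  "('k::field, 'r, 'm) module_scheme \<Rightarrow> ('k, 's, 'n) module_scheme
    \<Rightarrow> ('k, (('r \<times> 's) \<Rightarrow>\<^sub>0 'k) set) module" where
  "tensor_algebra R S =
    ring.extend (pair_algebra R S Quot tensor_ideal R S)
      (module.fields (\<lambda>c X. \<Union>p\<in>X. tensor_ideal R S +>\<^bsub>pair_algebra R S\<^esub> (c \<odot>\<^bsub>pair_algebra R S\<^esub> p)))"

definition pure_tensor ::
  "('k::field, 'r, 'm) module_scheme \<Rightarrow> ('k, 's, 'n) module_scheme \<Rightarrow> 'r \<Rightarrow> 's
    \<Rightarrow> (('r \<times> 's) \<Rightarrow>\<^sub>0 'k) set" where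
  "pure_tensor R S r s = tensor_ideal R S +>\<^bsub>pair_algebra R S\<^esub> Poly_Mapping.single (r, s) 1"

text \<open>\<^typ>\<open>'d \<Rightarrow>\<^sub>0 'k\<close> with its convolution product is the group ring.\<close>

definition group_ring :: "('k::field, 'd::ab_group_add \<Rightarrow>\<^sub>0 'k) module" where
  "group_ring = type_algebra pm_scale"

section \<open>Valuations and the associated graded algebra\<close>

text \<open>
  A valuation is a total function; its value at \<open>0\<close> is irrelevant and never used.
  Comparisons that may involve \<open>v(0) = \<infinity>\<close> go through \<open>val_ext\<close>.
\<close>

definition valuation_over ::
  "('k::field \<Rightarrow> 'b::idom \<Rightarrow> 'b) \<Rightarrow> ('b \<Rightarrow> 'g::linordered_ab_group_add) \<Rightarrow> bool" where
  "valuation_over scale v \<longleftrightarrow>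
     (\<forall>f g. f \<noteq> 0 \<and> g \<noteq> 0 \<and> f + g \<noteq> 0 \<longrightarrow> v (f + g) \<ge> min (v f) (v g))
   \<and> (\<forall>f g. f \<noteq> 0 \<and> g \<noteq> 0 \<longrightarrow> v (f * g) = v f + v g)
   \<and> (\<forall>c f. c \<noteq> 0 \<and> f \<noteq> 0 \<longrightarrow> v (scale c f) = v f)"

definition val_ext :: "('b::zero \<Rightarrow> 'g) \<Rightarrow> 'b \<Rightarrow> 'g extended" where
  "val_ext v f = (if f = 0 then Pinf else Fin (v f))"

definition F_ge :: "('b::zero \<Rightarrow> 'g::ord) \<Rightarrow> 'g \<Rightarrow> 'b set" where
  "F_ge v \<gamma> = {f. f \<noteq> 0 \<and> v f \<ge> \<gamma>} \<union> {0}"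

definition F_gt :: "('b::zero \<Rightarrow> 'g::ord) \<Rightarrow> 'g \<Rightarrow> 'b set" where
  "F_gt v \<gamma> = {f. f \<noteq> 0 \<and> v f > \<gamma>} \<union> {0}"

definition gr_class :: "('b::idom \<Rightarrow> 'g::ord) \<Rightarrow> 'g \<Rightarrow> 'b \<Rightarrow> 'b set" where
  "gr_class v \<gamma> f = (+) f ` F_gt v \<gamma>"

text \<open>
  The elements of the direct sum of the quotients \<open>F_ge v \<gamma> / F_gt v \<gamma>\<close> are the families
  \<open>\<phi>\<close> of cosets of which only finitely many differ from the zero class \<open>F_gt v \<gamma>\<close>.
  The component of \<open>\<phi> \<psi>\<close> in degree \<open>\<gamma>\<close> is the sum of the classes of \<open>p \<alpha> * q (\<gamma> - \<alpha>)\<close>,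
  where \<open>p\<close> and \<open>q\<close> are arbitrary systems of representatives of \<open>\<phi>\<close> and \<open>\<psi>\<close>.
\<close>

definition assoc_graded ::
  "('k::field \<Rightarrow> 'b::idom \<Rightarrow> 'b) \<Rightarrow> ('b \<Rightarrow> 'g::linordered_ab_group_add) \<Rightarrow> ('k, 'g \<Rightarrow> 'b set) module" where
  "assoc_graded scale v =
    \<lparr>carrier = {\<phi>. (\<forall>\<gamma>. \<phi> \<gamma> \<in> gr_class v \<gamma> ` F_ge v \<gamma>) \<and> finite {\<gamma>. \<phi> \<gamma> \<noteq> F_gt v \<gamma>}},
     mult = (\<lambda>\<phi> \<psi> \<gamma>. {(\<Sum>\<alpha> | \<phi> \<alpha> \<noteq> F_gt v \<alpha>. p \<alpha> * q (\<gamma> - \<alpha>)) + z | p q z.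
               (\<forall>\<alpha>. p \<alpha> \<in> \<phi> \<alpha>) \<and> (\<forall>\<alpha>. q \<alpha> \<in> \<psi> \<alpha>) \<and> z \<in> F_gt v \<gamma>}),
     one = (\<lambda>\<gamma>. gr_class v \<gamma> (if \<gamma> = 0 then 1 else 0)),
     zero = (\<lambda>\<gamma>. F_gt v \<gamma>),
     add = (\<lambda>\<phi> \<psi> \<gamma>. {x + y | x y. x \<in> \<phi> \<gamma> \<and> y \<in> \<psi> \<gamma>}),
     smult = (\<lambda>c \<phi> \<gamma>. {scale c x + z | x z. x \<in> \<phi> \<gamma> \<and> z \<in> F_gt v \<gamma>})\<rparr>"

definition initial_form ::
  "('b::idom \<Rightarrow> 'g::linordered_ab_group_add) \<Rightarrow> 'b \<Rightarrow> 'g \<Rightarrow> 'b set" where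
  "initial_form v f = (\<lambda>\<gamma>. gr_class v \<gamma> (if \<gamma> = v f then f else 0))"

section \<open>Gradings\<close>

text \<open>\<open>D \<delta>\<close> is the homogeneous component of \<open>A\<close> of degree \<open>\<delta>\<close>.\<close>

definition graded_by ::
  "('k::field \<Rightarrow> 'b::idom \<Rightarrow> 'b) \<Rightarrow> 'b set \<Rightarrow> ('d::ab_group_add \<Rightarrow> 'b set) \<Rightarrow> bool" where
  "graded_by scale A D \<longleftrightarrow>
     (\<forall>\<delta>. Modules.module.subspace scale (D \<delta>) \<and> D \<delta> \<subseteq> A)
   \<and> (\<forall>a\<in>A. \<exists>!c :: 'd \<Rightarrow>\<^sub>0 'b. (\<forall>\<delta>. Poly_Mapping.lookup c \<delta> \<in> D \<delta>)
        \<and> (\<Sum>\<delta>\<in>Poly_Mapping.keys c. Poly_Mapping.lookup c \<delta>) = a)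
   \<and> (\<forall>\<delta> \<epsilon>. \<forall>f\<in>D \<delta>. \<forall>g\<in>D \<epsilon>. f * g \<in> D (\<delta> + \<epsilon>))"

definition homogeneous :: "('d \<Rightarrow> 'b set) \<Rightarrow> 'b \<Rightarrow> bool" where
  "homogeneous D f \<longleftrightarrow> (\<exists>\<delta>. f \<in> D \<delta>)"

text \<open>Only used for non-zero homogeneous elements, whose degree is unique.\<close>

definition deg :: "('d \<Rightarrow> 'b set) \<Rightarrow> 'b \<Rightarrow> 'd" where
  "deg D f = (THE \<delta>. f \<in> D \<delta>)"

section \<open>Khovanskii bases\<close>

definition gr_tensor ::
  "('k::field \<Rightarrow> 'b::idom \<Rightarrow> 'b) \<Rightarrow> ('b \<Rightarrow> 'g::linordered_ab_group_add)
    \<Rightarrow> ('k, ((('g \<Rightarrow> 'b set) \<times> ('d::ab_group_add \<Rightarrow>\<^sub>0 'k)) \<Rightarrow>\<^sub>0 'k) set) module" where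
  "gr_tensor scale v = tensor_algebra (assoc_graded scale v) group_ring"

definition in_hom ::
  "('k::field \<Rightarrow> 'b::idom \<Rightarrow> 'b) \<Rightarrow> ('b \<Rightarrow> 'g::linordered_ab_group_add) \<Rightarrow> ('d::ab_group_add \<Rightarrow> 'b set)
    \<Rightarrow> 'b \<Rightarrow> ((('g \<Rightarrow> 'b set) \<times> ('d \<Rightarrow>\<^sub>0 'k)) \<Rightarrow>\<^sub>0 'k) set" where
  "in_hom scale v D f =
     pure_tensor (assoc_graded scale v) group_ring
       (initial_form v f) (Poly_Mapping.single (deg D f) 1)"

definition in_hom_alg ::
  "('k::field \<Rightarrow> 'b::idom \<Rightarrow> 'b) \<Rightarrow> ('b \<Rightarrow> 'g::linordered_ab_group_add) \<Rightarrow> ('d::ab_group_add \<Rightarrow> 'b set)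
    \<Rightarrow> 'b set \<Rightarrow> ((('g \<Rightarrow> 'b set) \<times> ('d \<Rightarrow>\<^sub>0 'k)) \<Rightarrow>\<^sub>0 'k) set set" where
  "in_hom_alg scale v D S =
     generated_subalg (gr_tensor scale v) {in_hom scale v D f | f. f \<in> S \<and> f \<noteq> 0 \<and> homogeneous D f}"

definition homogeneous_generators ::
  "('k::field \<Rightarrow> 'b::idom \<Rightarrow> 'b) \<Rightarrow> 'b set \<Rightarrow> ('d \<Rightarrow> 'b set) \<Rightarrow> 'b set \<Rightarrow> bool" where
  "homogeneous_generators scale A D G \<longleftrightarrow>
     G \<subseteq> A \<and> (\<forall>g\<in>G. homogeneous D g) \<and> generated_subalg (type_algebra scale) G = A"

definition Khovanskii_basis ::
  "('k::field \<Rightarrow> 'b::idom \<Rightarrow> 'b) \<Rightarrow> 'b set \<Rightarrow> ('d::ab_group_add \<Rightarrow> 'b set)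
    \<Rightarrow> ('b \<Rightarrow> 'g::linordered_ab_group_add) \<Rightarrow> 'b set \<Rightarrow> bool" where
  "Khovanskii_basis scale A D v G \<longleftrightarrow>
     homogeneous_generators scale A D G
   \<and> generated_subalg (gr_tensor scale v) (in_hom scale v D ` (G - {0})) = in_hom_alg scale v D A"

section \<open>MUVAK bases\<close>

text \<open>The indeterminates \<open>X\<^sub>1, \<dots>, X\<^sub>k\<close> are numbered from \<open>0\<close>.\<close>

definition faithfully_representable ::
  "('k::field \<Rightarrow> 'b::idom \<Rightarrow> 'b) \<Rightarrow> ('b \<Rightarrow> 'g::linordered_ab_group_add) list \<Rightarrow> 'b list \<Rightarrow> 'b \<Rightarrow> bool" where
  "faithfully_representable scale vs fs f \<longleftrightarrow>
     (\<exists>h :: (nat, 'k) mpoly. indets h \<subseteq> {..<length fs}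
        \<and> eval_poly (type_algebra scale) ((!) fs) h = f
        \<and> (\<forall>m\<in>Poly_Mapping.keys h. \<forall>v\<in>set vs.
             val_ext v (eval_term (type_algebra scale) ((!) fs) h m) \<ge> val_ext v f))"

definition MUVAK_basis ::
  "('k::field \<Rightarrow> 'b::idom \<Rightarrow> 'b) \<Rightarrow> 'b set \<Rightarrow> ('d::ab_group_add \<Rightarrow> 'b set)
    \<Rightarrow> ('b \<Rightarrow> 'g::linordered_ab_group_add) list \<Rightarrow> 'b set \<Rightarrow> bool" where
  "MUVAK_basis scale A D vs G \<longleftrightarrow>
     homogeneous_generators scale A D G
   \<and> (\<forall>f\<in>A. homogeneous D f \<longrightarrow>
        (\<exists>fs. set fs \<subseteq> G \<and> faithfully_representable scale vs fs f))"

section \<open>The homogeneous subduction algorithm\<close>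

text \<open>
  The indeterminate \<open>X\<^sub>g\<close> is \<open>g\<close> itself.  A state of the algorithm is the triple
  \<open>(\<G>', h, r)\<close>.  The choice made in the loop body is given by a function (the ``fixed rule'')
  of the input set and of the current state.
\<close>

type_synonym ('b, 'k) subduction_state = "'b set \<times> ('b, 'k) mpoly \<times> 'b"
type_synonym ('b, 'k) choice_rule = "'b set \<Rightarrow> ('b, 'k) subduction_state \<Rightarrow> 'b set \<times> ('b, 'k) mpoly"

definition subduction_continues ::
  "('k::field \<Rightarrow> 'b::idom \<Rightarrow> 'b) \<Rightarrow> ('d::ab_group_add \<Rightarrow> 'b set)
    \<Rightarrow> ('b \<Rightarrow> 'g::linordered_ab_group_add) \<Rightarrow> 'b set \<Rightarrow> 'b \<Rightarrow> bool" where
  "subduction_continues scale D v G r \<longleftrightarrow> r \<noteq> 0 \<and> in_hom scale v D r \<in> in_hom_alg scale v D G"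

definition admissible_choice ::
  "('k::field \<Rightarrow> 'b::idom \<Rightarrow> 'b) \<Rightarrow> ('d::ab_group_add \<Rightarrow> 'b set)
    \<Rightarrow> ('b \<Rightarrow> 'g::linordered_ab_group_add) \<Rightarrow> 'b set \<Rightarrow> 'b \<Rightarrow> 'b set \<Rightarrow> ('b, 'k) mpoly \<Rightarrow> bool" where
  "admissible_choice scale D v G r F h' \<longleftrightarrow>
     finite F \<and> F \<subseteq> G \<and> indets h' \<subseteq> F
   \<and> eval_poly (gr_tensor scale v) (in_hom scale v D) h' = in_hom scale v D r
   \<and> (\<forall>m\<in>Poly_Mapping.keys h'.
        val_ext v (eval_term (type_algebra scale) (\<lambda>g. g) h' m) \<ge> val_ext v r
      \<and> deg D (eval_term (type_algebra scale) (\<lambda>g. g) h' m) = deg D r)"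

definition valid_rule ::
  "('k::field \<Rightarrow> 'b::idom \<Rightarrow> 'b) \<Rightarrow> 'b set \<Rightarrow> ('d::ab_group_add \<Rightarrow> 'b set)
    \<Rightarrow> ('b \<Rightarrow> 'g::linordered_ab_group_add) \<Rightarrow> ('b, 'k) choice_rule \<Rightarrow> bool" where
  "valid_rule scale A D v rule \<longleftrightarrow>
     (\<forall>G G' h r F h'. G \<subseteq> A - {0} \<and> (\<forall>g\<in>G. homogeneous D g) \<and> r \<in> A \<and> homogeneous D r
        \<and> subduction_continues scale D v G r \<and> rule G (G', h, r) = (F, h')
        \<longrightarrow> admissible_choice scale D v G r F h')"

text \<open>\<^const>\<open>while_option\<close> returns \<open>None\<close> iff the loop does not end after finitely many steps.\<close>

definition subduction ::
  "('k::field \<Rightarrow> 'b::idom \<Rightarrow> 'b) \<Rightarrow> ('d::ab_group_add \<Rightarrow> 'b set)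
    \<Rightarrow> ('b \<Rightarrow> 'g::linordered_ab_group_add) \<Rightarrow> ('b, 'k) choice_rule \<Rightarrow> 'b set \<Rightarrow> 'b
    \<Rightarrow> ('b, 'k) subduction_state option" where
  "subduction scale D v rule G f =
     while_option
       (\<lambda>(G', h, r). subduction_continues scale D v G r)
       (\<lambda>(G', h, r). case rule G (G', h, r) of (F, h') \<Rightarrow>
          (G' \<union> F, h + h', r - eval_poly (type_algebra scale) (\<lambda>g. g) h'))
       ({}, 0, f)"

definition subduction_terminates ::
  "('k::field \<Rightarrow> 'b::idom \<Rightarrow> 'b) \<Rightarrow> 'b set \<Rightarrow> ('d::ab_group_add \<Rightarrow> 'b set)
    \<Rightarrow> ('b \<Rightarrow> 'g::linordered_ab_group_add) \<Rightarrow> ('b, 'k) choice_rule \<Rightarrow> bool" where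
  "subduction_terminates scale A D v rule \<longleftrightarrow>
     (\<forall>f G. f \<in> A \<and> homogeneous D f \<and> G \<subseteq> A - {0} \<and> (\<forall>g\<in>G. homogeneous D g)
        \<longrightarrow> subduction scale D v rule G f \<noteq> None)"

end

theory Submission
  imports Defs
begin

text \<open>
  If a homogeneous \<open>f\<close> is faithfully represented by \<open>h\<close>, discard the terms of \<open>h\<close> whose degree
  differs from that of \<open>f\<close>; the remaining terms still sum to \<open>f\<close>, and those of minimal value
  exhibit the initial form of \<open>f\<close> as a polynomial in the initial forms of the generators.
  Conversely, each subduction step subtracts terms of value at least that of the current
  remainder, so the accumulated polynomial represents faithfully what has been subtracted
  from \<open>f\<close>.  Over a Khovanskii basis the loop can only end with remainder \<open>0\<close>.
\<close>

section \<open>Linear extension to free vector spaces\<close>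

text \<open>Initial forms are multiplicative but not additive: a sum may jump in value or vanish,
  and its summands may have different degrees. Products are therefore handled by
  \<open>in_hom\<close>, on non-zero homogeneous elements (closed under products since
  \<open>B\<close> is a domain), and sums by \<open>graded_class\<close> with both degrees fixed,
  which is linear on \<open>F_ge v \<gamma>\<close> and collapses \<open>F_gt v \<gamma>\<close> to
  the zero class. These classes live in a quotient of a free vector space over a direct sum of
  quotients, so every operation must first be shown to be computable on representatives; these two
  layers of coset arithmetic make up the first half of the development. In the converse direction
  the bound on values is carried by monomials rather than by terms, because coefficients merge when
  polynomials are added.\<close>

lemma lookup_pm_scale [simp]:
  "Poly_Mapping.lookup (pm_scale c p) x = c * Poly_Mapping.lookup p x"
  for c :: "'k::mult_zero"
  by (simp add: pm_scale_def Poly_Mapping.map.rep_eq when_def)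

interpretation pm: vector_space "pm_scale :: 'k::field \<Rightarrow> ('a \<Rightarrow>\<^sub>0 'k) \<Rightarrow> _"
  by standard (auto intro!: poly_mapping_eqI simp: lookup_add algebra_simps)

lemma pm_scale_single [simp]:
  "pm_scale c (Poly_Mapping.single x d) = Poly_Mapping.single x (c * d)"
  for c :: "'k::field"
  by (intro poly_mapping_eqI) (simp add: lookup_single when_def)

lemma pm_scale_mult_left: "pm_scale c (p * q) = pm_scale c p * q"
  for p q :: "'d::ab_group_add \<Rightarrow>\<^sub>0 'k::field"
  by (simp add: pm_scale_def mult_map_scale_conv_mult mult.assoc)

definition lin_ext :: "('x \<Rightarrow> 'y \<Rightarrow>\<^sub>0 'k::field) \<Rightarrow> ('x \<Rightarrow>\<^sub>0 'k) \<Rightarrow> ('y \<Rightarrow>\<^sub>0 'k)" where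
  "lin_ext g p = (\<Sum>x\<in>Poly_Mapping.keys p. pm_scale (Poly_Mapping.lookup p x) (g x))"

lemma lin_ext_zero [simp]: "lin_ext g 0 = 0"
  by (simp add: lin_ext_def)

lemma lin_ext_add: "lin_ext g (p + q) = lin_ext g p + lin_ext g q"
  unfolding lin_ext_def
  by (rule setsum_keys_plus_distrib) (auto simp: pm.scale_left_distrib)

lemma lin_ext_scale: "lin_ext g (pm_scale c p) = pm_scale c (lin_ext g p)"
proof -
  have "lin_ext g (pm_scale c p)
      = (\<Sum>x\<in>Poly_Mapping.keys p. pm_scale (Poly_Mapping.lookup (pm_scale c p) x) (g x))"
    unfolding lin_ext_def by (rule sum.mono_neutral_left) (auto simp: in_keys_iff)
  then show ?thesis
    by (simp add: lin_ext_def pm.scale_sum_right)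
qed

lemma lin_ext_diff: "lin_ext g (p - q) = lin_ext g p - lin_ext g q"
  using lin_ext_add[of g "p - q" q] by simp

lemma lin_ext_single [simp]: "lin_ext g (Poly_Mapping.single x c) = pm_scale c (g x)"
  by (cases "c = 0") (simp_all add: lin_ext_def)

lemma lin_ext_span:
  assumes "p \<in> pm.span X" and "\<And>x. x \<in> X \<Longrightarrow> lin_ext g x \<in> pm.span Y"
  shows "lin_ext g p \<in> pm.span Y"
  using assms(1)
proof (induction rule: pm.span_induct_alt)
  case base
  then show ?case by (simp add: pm.span_zero)
next
  case (step c x p)
  then show ?case
    by (simp add: lin_ext_add lin_ext_scale pm.span_add pm.span_scale assms(2))
qed

section \<open>Tensor products\<close>

text \<open>
  Associativity and units play no role for the ideal of bilinearity relations, so only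
  closure and bilinearity of the multiplication are required of the tensor factors.
\<close>

locale prealgebra =
  fixes R :: "('k::field, 'r, 'm) module_scheme" (structure)
  assumes add_closed: "\<And>x y. x \<in> carrier R \<Longrightarrow> y \<in> carrier R \<Longrightarrow> x \<oplus> y \<in> carrier R"
    and mult_closed: "\<And>x y. x \<in> carrier R \<Longrightarrow> y \<in> carrier R \<Longrightarrow> x \<otimes> y \<in> carrier R"
    and smult_closed: "\<And>c x. x \<in> carrier R \<Longrightarrow> c \<odot> x \<in> carrier R"
    and distrib_right: "\<And>x y z. x \<in> carrier R \<Longrightarrow> y \<in> carrier R \<Longrightarrow> z \<in> carrier R
      \<Longrightarrow> (x \<oplus> y) \<otimes> z = x \<otimes> z \<oplus> y \<otimes> z"
    and distrib_left: "\<And>x y z. x \<in> carrier R \<Longrightarrow> y \<in> carrier R \<Longrightarrow> z \<in> carrier R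
      \<Longrightarrow> x \<otimes> (y \<oplus> z) = x \<otimes> y \<oplus> x \<otimes> z"
    and smult_mult_left: "\<And>c x y. x \<in> carrier R \<Longrightarrow> y \<in> carrier R \<Longrightarrow> (c \<odot> x) \<otimes> y = c \<odot> (x \<otimes> y)"
    and smult_mult_right: "\<And>c x y. x \<in> carrier R \<Longrightarrow> y \<in> carrier R \<Longrightarrow> x \<otimes> (c \<odot> y) = c \<odot> (x \<otimes> y)"

locale tensor_factors = R: prealgebra R + S: prealgebra S
  for R :: "('k::field, 'r, 'm) module_scheme" and S :: "('k, 's, 'n) module_scheme"
begin

abbreviation P where "P \<equiv> pair_algebra R S"
abbreviation I where "I \<equiv> tensor_ideal R S"
abbreviation T where "T \<equiv> tensor_algebra R S"

definition pair_mult where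
  "pair_mult x y = (fst x \<otimes>\<^bsub>R\<^esub> fst y, snd x \<otimes>\<^bsub>S\<^esub> snd y)"

lemma P_simps:
  "carrier P = {p. Poly_Mapping.keys p \<subseteq> carrier R \<times> carrier S}"
  "p \<oplus>\<^bsub>P\<^esub> q = p + q" "c \<odot>\<^bsub>P\<^esub> p = pm_scale c p" "\<zero>\<^bsub>P\<^esub> = 0"
  "\<one>\<^bsub>P\<^esub> = Poly_Mapping.single (\<one>\<^bsub>R\<^esub>, \<one>\<^bsub>S\<^esub>) 1"
  by (simp_all add: pair_algebra_def)

lemma P_mult_left:
  "p \<otimes>\<^bsub>P\<^esub> q = lin_ext (\<lambda>x. lin_ext (\<lambda>y. Poly_Mapping.single (pair_mult x y) 1) q) p"
  by (simp add: pair_algebra_def lin_ext_def pm.scale_sum_right pair_mult_def case_prod_unfold)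

text \<open>Exchanges the two finite sums of \<open>P_mult_left\<close>. With the second factor
  outside, the inner expression is linear in \<open>p\<close>, which is what a reduction to
  generators of the ideal in the first factor requires.\<close>

lemma P_mult_right:
  "p \<otimes>\<^bsub>P\<^esub> q = lin_ext (\<lambda>y. lin_ext (\<lambda>x. Poly_Mapping.single (pair_mult x y) 1) p) q"
  unfolding P_mult_left lin_ext_def
  by (simp add: pm.scale_sum_right mult.commute) (rule sum.swap)

lemma P_mult_add_left: "(p + p') \<otimes>\<^bsub>P\<^esub> q = p \<otimes>\<^bsub>P\<^esub> q + p' \<otimes>\<^bsub>P\<^esub> q"
  by (simp add: P_mult_left lin_ext_add)

lemma P_mult_add_right: "p \<otimes>\<^bsub>P\<^esub> (q + q') = p \<otimes>\<^bsub>P\<^esub> q + p \<otimes>\<^bsub>P\<^esub> q'"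
  by (simp add: P_mult_right lin_ext_add)

lemma P_mult_single:
  "Poly_Mapping.single (r, s) 1 \<otimes>\<^bsub>P\<^esub> Poly_Mapping.single (r', s') 1
    = Poly_Mapping.single (r \<otimes>\<^bsub>R\<^esub> r', s \<otimes>\<^bsub>S\<^esub> s') 1"
  by (simp add: P_mult_left pair_mult_def)

lemma I_def: "I = pm.span (bilinear_relations R S)"
  by (simp add: tensor_ideal_def)

lemma relation_add_left:
  assumes "r \<in> carrier R" "r' \<in> carrier R" "s \<in> carrier S"
  shows "Poly_Mapping.single (r \<oplus>\<^bsub>R\<^esub> r', s) 1 - Poly_Mapping.single (r, s) 1
        - Poly_Mapping.single (r', s) 1 \<in> I"
  unfolding I_def bilinear_relations_def using assms by (intro pm.span_base) blast

lemma relation_add_right: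
  assumes "r \<in> carrier R" "s \<in> carrier S" "s' \<in> carrier S"
  shows "Poly_Mapping.single (r, s \<oplus>\<^bsub>S\<^esub> s') 1 - Poly_Mapping.single (r, s) 1
        - Poly_Mapping.single (r, s') 1 \<in> I"
  unfolding I_def bilinear_relations_def using assms by (intro pm.span_base) blast

lemma relation_smult_left:
  assumes "r \<in> carrier R" "s \<in> carrier S"
  shows "Poly_Mapping.single (c \<odot>\<^bsub>R\<^esub> r, s) 1 - Poly_Mapping.single (r, s) c \<in> I"
  unfolding I_def bilinear_relations_def using assms by (intro pm.span_base) blast

lemma relation_smult_right:
  assumes "r \<in> carrier R" "s \<in> carrier S"
  shows "Poly_Mapping.single (r, c \<odot>\<^bsub>S\<^esub> s) 1 - Poly_Mapping.single (r, s) c \<in> I"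
  unfolding I_def bilinear_relations_def using assms by (intro pm.span_base) blast

lemma I_zero: "0 \<in> I" and I_add: "p \<in> I \<Longrightarrow> q \<in> I \<Longrightarrow> p + q \<in> I"
  and I_diff: "p \<in> I \<Longrightarrow> q \<in> I \<Longrightarrow> p - q \<in> I" and I_scale: "p \<in> I \<Longrightarrow> pm_scale c p \<in> I"
  by (simp_all add: I_def pm.span_zero pm.span_add pm.span_diff pm.span_scale)

lemma single_in_P: "r \<in> carrier R \<Longrightarrow> s \<in> carrier S \<Longrightarrow> Poly_Mapping.single (r, s) c \<in> carrier P"
  by (simp add: P_simps)

lemma P_subspace: "pm.subspace (carrier P)"
  unfolding pm.subspace_def
proof (intro conjI ballI allI)
  fix c p q assume "p \<in> carrier P" "q \<in> carrier P"
  then have pq: "Poly_Mapping.keys p \<subseteq> carrier R \<times> carrier S"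
      "Poly_Mapping.keys q \<subseteq> carrier R \<times> carrier S"
    by (simp_all add: P_simps)
  then show "p + q \<in> carrier P"
    using keys_add[of p q] by (simp add: P_simps) blast
  have "Poly_Mapping.keys (pm_scale c p) \<subseteq> Poly_Mapping.keys p"
    by (auto simp: in_keys_iff)
  with pq show "pm_scale c p \<in> carrier P"
    by (simp add: P_simps)
qed (simp add: P_simps)

section \<open>The span of the bilinearity relations as a two-sided ideal\<close>

lemma I_subset: "I \<subseteq> carrier P"
  unfolding I_def
  by (rule pm.span_minimal[OF _ P_subspace])
    (auto simp: bilinear_relations_def R.add_closed S.add_closed R.smult_closed S.smult_closed
      intro!: pm.subspace_diff[OF P_subspace] single_in_P)

lemma lin_ext_in_I: "(\<And>x. x \<in> Poly_Mapping.keys p \<Longrightarrow> g x \<in> I) \<Longrightarrow> lin_ext g p \<in> I"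
  unfolding lin_ext_def I_def by (intro pm.span_sum pm.span_scale) auto

text \<open>By bilinearity it suffices to multiply one bilinearity relation by one basis pair
  \<open>y\<close>. Distributivity and compatibility with scalars in \<open>R\<close> and
  \<open>S\<close> turn the result into a relation of the same kind.\<close>

lemma I_mult_right:
  assumes p: "p \<in> I" and q: "q \<in> carrier P"
  shows "p \<otimes>\<^bsub>P\<^esub> q \<in> I"
  unfolding P_mult_right
proof (rule lin_ext_in_I)
  fix y assume "y \<in> Poly_Mapping.keys q"
  with q have y: "fst y \<in> carrier R" "snd y \<in> carrier S"
    by (auto simp: P_simps)
  show "lin_ext (\<lambda>x. Poly_Mapping.single (pair_mult x y) 1) p \<in> I"
    unfolding I_def
  proof (rule lin_ext_span)
    show "p \<in> pm.span (bilinear_relations R S)" using p by (simp add: I_def)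
    show "lin_ext (\<lambda>x. Poly_Mapping.single (pair_mult x y) 1) x \<in> pm.span (bilinear_relations R S)"
      if "x \<in> bilinear_relations R S" for x
      \<comment> \<open>The second equation folds the span of the unfolded relation set back into
        \<open>I\<close>, so that the lemmas \<open>relation_add_left\<close> etc. match the
        resulting goals.\<close>
      using that y unfolding bilinear_relations_def I_def[symmetric, unfolded bilinear_relations_def]
      by (auto simp: lin_ext_diff pair_mult_def R.distrib_right S.distrib_right R.smult_mult_left
          S.smult_mult_left intro!: relation_add_left relation_add_right relation_smult_left
          relation_smult_right R.mult_closed S.mult_closed)
  qed
qed

lemma I_mult_left:
  assumes p: "p \<in> I" and q: "q \<in> carrier P"
  shows "q \<otimes>\<^bsub>P\<^esub> p \<in> I"
  unfolding P_mult_left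
proof (rule lin_ext_in_I)
  fix y assume "y \<in> Poly_Mapping.keys q"
  with q have y: "fst y \<in> carrier R" "snd y \<in> carrier S"
    by (auto simp: P_simps)
  show "lin_ext (\<lambda>x. Poly_Mapping.single (pair_mult y x) 1) p \<in> I"
    unfolding I_def
  proof (rule lin_ext_span)
    show "p \<in> pm.span (bilinear_relations R S)" using p by (simp add: I_def)
    show "lin_ext (\<lambda>x. Poly_Mapping.single (pair_mult y x) 1) x \<in> pm.span (bilinear_relations R S)"
      if "x \<in> bilinear_relations R S" for x
      using that y unfolding bilinear_relations_def I_def[symmetric, unfolded bilinear_relations_def]
      by (auto simp: lin_ext_diff pair_mult_def R.distrib_left S.distrib_left R.smult_mult_right
          S.smult_mult_right intro!: relation_add_left relation_add_right relation_smult_left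
          relation_smult_right R.mult_closed S.mult_closed)
  qed
qed

section \<open>Arithmetic of cosets in the tensor product\<close>

lemma T_simps:
  "X \<oplus>\<^bsub>T\<^esub> Y = X <+>\<^bsub>P\<^esub> Y" "X \<otimes>\<^bsub>T\<^esub> Y = rcoset_mult P I X Y" "\<one>\<^bsub>T\<^esub> = I +>\<^bsub>P\<^esub> \<one>\<^bsub>P\<^esub>"
  "c \<odot>\<^bsub>T\<^esub> X = (\<Union>p\<in>X. I +>\<^bsub>P\<^esub> (c \<odot>\<^bsub>P\<^esub> p))"
  by (simp_all add: tensor_algebra_def ring.defs module.defs FactRing_def)

lemma coset_eq_image: "I +>\<^bsub>P\<^esub> p = (\<lambda>i. i + p) ` I"
  by (auto simp: a_r_coset_def' P_simps)

lemma coset_eqI: "p - q \<in> I \<Longrightarrow> I +>\<^bsub>P\<^esub> p = I +>\<^bsub>P\<^esub> q"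
proof -
  have *: "I +>\<^bsub>P\<^esub> p \<subseteq> I +>\<^bsub>P\<^esub> q" if "p - q \<in> I" for p q
  proof
    fix x assume "x \<in> I +>\<^bsub>P\<^esub> p"
    then obtain i where i: "i \<in> I" "x = (i + (p - q)) + q" by (auto simp: coset_eq_image)
    then show "x \<in> I +>\<^bsub>P\<^esub> q" unfolding coset_eq_image using I_add[OF i(1) that] by blast
  qed
  assume "p - q \<in> I"
  moreover from I_diff[OF I_zero this] have "q - p \<in> I" by simp
  ultimately show ?thesis using * by blast
qed

lemma T_add_coset: "(I +>\<^bsub>P\<^esub> p) \<oplus>\<^bsub>T\<^esub> (I +>\<^bsub>P\<^esub> q) = I +>\<^bsub>P\<^esub> (p + q)"
proof -
  have "(I +>\<^bsub>P\<^esub> p) \<oplus>\<^bsub>T\<^esub> (I +>\<^bsub>P\<^esub> q) = {(i + p) + (j + q) | i j. i \<in> I \<and> j \<in> I}"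
    by (auto simp: T_simps set_add_def' coset_eq_image P_simps)
  also have "\<dots> = (\<lambda>i. i + (p + q)) ` I"
  proof (intro equalityI subsetI)
    fix x assume "x \<in> {(i + p) + (j + q) | i j. i \<in> I \<and> j \<in> I}"
    then obtain i j where "i \<in> I" "j \<in> I" "x = (i + j) + (p + q)" by (auto simp: algebra_simps)
    then show "x \<in> (\<lambda>i. i + (p + q)) ` I" using I_add by auto
  next
    fix x assume "x \<in> (\<lambda>i. i + (p + q)) ` I"
    then obtain i where "i \<in> I" "x = (i + p) + (0 + q)" by (auto simp: algebra_simps)
    then show "x \<in> {(i + p) + (j + q) | i j. i \<in> I \<and> j \<in> I}" using I_zero by blast
  qed
  finally show ?thesis by (simp add: coset_eq_image)
qed

text \<open>\<open>rcoset_mult\<close> is a union over all pairs of representatives. Replacing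
  \<open>p\<close>, \<open>q\<close> by \<open>i + p\<close>, \<open>j + q\<close> changes the
  product by \<open>i (j + q) + p j\<close>, which lies in the two-sided ideal \<open>I\<close>, so
  all members of the union coincide.\<close>

lemma T_mult_coset:
  assumes "p \<in> carrier P" "q \<in> carrier P"
  shows "(I +>\<^bsub>P\<^esub> p) \<otimes>\<^bsub>T\<^esub> (I +>\<^bsub>P\<^esub> q) = I +>\<^bsub>P\<^esub> (p \<otimes>\<^bsub>P\<^esub> q)"
proof -
  have "I +>\<^bsub>P\<^esub> ((i + p) \<otimes>\<^bsub>P\<^esub> (j + q)) = I +>\<^bsub>P\<^esub> (p \<otimes>\<^bsub>P\<^esub> q)" if "i \<in> I" "j \<in> I" for i j
  proof (rule coset_eqI)
    have "(i + p) \<otimes>\<^bsub>P\<^esub> (j + q) - p \<otimes>\<^bsub>P\<^esub> q = i \<otimes>\<^bsub>P\<^esub> (j + q) + p \<otimes>\<^bsub>P\<^esub> j"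
      by (simp add: P_mult_add_left P_mult_add_right)
    moreover have "j + q \<in> carrier P"
      using that I_subset assms by (intro pm.subspace_add[OF P_subspace]) auto
    ultimately show "(i + p) \<otimes>\<^bsub>P\<^esub> (j + q) - p \<otimes>\<^bsub>P\<^esub> q \<in> I"
      using that assms by (simp add: I_add I_mult_left I_mult_right)
  qed
  then show ?thesis
    using I_zero by (force simp: T_simps rcoset_mult_def coset_eq_image[of p] coset_eq_image[of q])
qed

lemma T_smult_coset: "c \<odot>\<^bsub>T\<^esub> (I +>\<^bsub>P\<^esub> p) = I +>\<^bsub>P\<^esub> pm_scale c p"
proof -
  have "I +>\<^bsub>P\<^esub> pm_scale c (i + p) = I +>\<^bsub>P\<^esub> pm_scale c p" if "i \<in> I" for i
    using that by (intro coset_eqI) (simp add: pm.scale_right_distrib I_scale)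
  then show ?thesis
    using I_zero by (force simp: T_simps coset_eq_image[of p] P_simps(3))
qed

lemma T_smult_zero: "0 \<odot>\<^bsub>T\<^esub> (I +>\<^bsub>P\<^esub> p) = 0 \<odot>\<^bsub>T\<^esub> (I +>\<^bsub>P\<^esub> q)"
  by (simp add: T_smult_coset)

lemma T_one: "\<one>\<^bsub>T\<^esub> = pure_tensor R S \<one>\<^bsub>R\<^esub> \<one>\<^bsub>S\<^esub>"
  by (simp add: T_simps pure_tensor_def P_simps)

lemma pure_tensor_add_left:
  assumes "r \<in> carrier R" "r' \<in> carrier R" "s \<in> carrier S"
  shows "pure_tensor R S r s \<oplus>\<^bsub>T\<^esub> pure_tensor R S r' s = pure_tensor R S (r \<oplus>\<^bsub>R\<^esub> r') s"
  unfolding pure_tensor_def T_add_coset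
  using relation_add_left[OF assms] by (intro coset_eqI[symmetric]) (simp add: diff_diff_eq)

lemma pure_tensor_mult:
  assumes "r \<in> carrier R" "r' \<in> carrier R" "s \<in> carrier S" "s' \<in> carrier S"
  shows "pure_tensor R S r s \<otimes>\<^bsub>T\<^esub> pure_tensor R S r' s'
    = pure_tensor R S (r \<otimes>\<^bsub>R\<^esub> r') (s \<otimes>\<^bsub>S\<^esub> s')"
  unfolding pure_tensor_def using assms by (simp add: T_mult_coset single_in_P P_mult_single)

lemma pure_tensor_smult_left:
  assumes "r \<in> carrier R" "s \<in> carrier S"
  shows "c \<odot>\<^bsub>T\<^esub> pure_tensor R S r s = pure_tensor R S (c \<odot>\<^bsub>R\<^esub> r) s"
  unfolding pure_tensor_def T_smult_coset
  using relation_smult_left[OF assms] by (intro coset_eqI[symmetric]) simp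

lemma pure_tensor_smult_zero: "0 \<odot>\<^bsub>T\<^esub> pure_tensor R S r s = 0 \<odot>\<^bsub>T\<^esub> pure_tensor R S r' s'"
  unfolding pure_tensor_def by (rule T_smult_zero)

end

interpretation group_ring: prealgebra "group_ring :: ('k::field, 'd::ab_group_add \<Rightarrow>\<^sub>0 'k) module"
proof
  fix c :: 'k and x y :: "'d \<Rightarrow>\<^sub>0 'k"
  show "x \<otimes>\<^bsub>group_ring\<^esub> (c \<odot>\<^bsub>group_ring\<^esub> y) = c \<odot>\<^bsub>group_ring\<^esub> (x \<otimes>\<^bsub>group_ring\<^esub> y)"
    using pm_scale_mult_left[of c y x] 
    by (simp add: group_ring_def type_algebra_def mult.commute[of x])
qed (simp_all add: group_ring_def type_algebra_def distrib_left distrib_right pm_scale_mult_left)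

section \<open>The associated graded algebra\<close>

text \<open>In a group the equation \<open>k = l + m\<close> has the single solution
  \<open>m = k - l\<close>, which collapses the inner sum of the convolution. The result has the
  shape of the product in \<open>assoc_graded\<close>.\<close>

lemma lookup_mult_keys:
  "Poly_Mapping.lookup (p * q) k
    = (\<Sum>l\<in>Poly_Mapping.keys p. Poly_Mapping.lookup p l * Poly_Mapping.lookup q (k - l))"
  for p q :: "'g::ab_group_add \<Rightarrow>\<^sub>0 'b::comm_ring_1"
proof -
  have "(\<Sum>m. Poly_Mapping.lookup q m when k = l + m) = Poly_Mapping.lookup q (k - l)" for l
  proof -
    have "(k = l + m) = (m = k - l)" for m by (auto simp: algebra_simps)
    then show ?thesis by simp
  qed
  then show ?thesis
    by (simp add: lookup_mult)
      (rule Sum_any.expand_superset, auto simp: in_keys_iff)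
qed

locale valued_algebra = K_algebra scale
  for scale :: "'k::field \<Rightarrow> 'b::idom \<Rightarrow> 'b" +
  fixes v :: "'b \<Rightarrow> 'g::linordered_ab_group_add"
  assumes valuation: "valuation_over scale v"
begin

section \<open>The filtration of \<open>B\<close> by values\<close>

lemma v_add: "f \<noteq> 0 \<Longrightarrow> g \<noteq> 0 \<Longrightarrow> f + g \<noteq> 0 \<Longrightarrow> min (v f) (v g) \<le> v (f + g)"
  and v_mult: "f \<noteq> 0 \<Longrightarrow> g \<noteq> 0 \<Longrightarrow> v (f * g) = v f + v g"
  and v_scale: "c \<noteq> 0 \<Longrightarrow> f \<noteq> 0 \<Longrightarrow> v (scale c f) = v f"
  using valuation by (auto simp: valuation_over_def)

lemma v_one: "v 1 = 0"
  using v_mult[of 1 1] by simp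

lemma v_uminus: "v (- f) = v f"
  by (cases "f = 0") (use v_scale[of "-1" f] in auto)

text \<open>Turns scalars into ring elements, so that scalar multiplication of families becomes
  multiplication by a constant family concentrated in degree 0.\<close>

lemma scale_conv_mult: "scale c x = scale c 1 * x"
  using scale_mult_left[of c 1 x] by simp

lemma F_ge_iff: "x \<in> F_ge v \<gamma> \<longleftrightarrow> x = 0 \<or> \<gamma> \<le> v x"
  and F_gt_iff: "x \<in> F_gt v \<gamma> \<longleftrightarrow> x = 0 \<or> \<gamma> < v x"
  by (auto simp: F_ge_def F_gt_def)

lemma F_gt_imp_F_ge: "x \<in> F_gt v \<gamma> \<Longrightarrow> x \<in> F_ge v \<gamma>"
  by (auto simp: F_ge_iff F_gt_iff)

lemma F_ge_add: "x \<in> F_ge v \<gamma> \<Longrightarrow> y \<in> F_ge v \<gamma> \<Longrightarrow> x + y \<in> F_ge v \<gamma>"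
  using v_add[of x y]
  by (cases "x = 0"; cases "y = 0"; cases "x + y = 0") (auto simp: F_ge_iff min_def split: if_splits)

lemma F_gt_add: "x \<in> F_gt v \<gamma> \<Longrightarrow> y \<in> F_gt v \<gamma> \<Longrightarrow> x + y \<in> F_gt v \<gamma>"
  using v_add[of x y]
  by (cases "x = 0"; cases "y = 0"; cases "x + y = 0") (auto simp: F_gt_iff min_def split: if_splits)

lemma F_gt_uminus: "x \<in> F_gt v \<gamma> \<Longrightarrow> - x \<in> F_gt v \<gamma>"
  by (auto simp: F_gt_iff v_uminus)

lemma F_gt_diff: "x \<in> F_gt v \<gamma> \<Longrightarrow> y \<in> F_gt v \<gamma> \<Longrightarrow> x - y \<in> F_gt v \<gamma>"
  using F_gt_add[of x \<gamma> "- y"] F_gt_uminus[of y] by simp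

lemma F_ge_uminus: "x \<in> F_ge v \<gamma> \<Longrightarrow> - x \<in> F_ge v \<gamma>"
  by (auto simp: F_ge_iff v_uminus)

lemma F_ge_diff: "x \<in> F_ge v \<gamma> \<Longrightarrow> y \<in> F_ge v \<gamma> \<Longrightarrow> x - y \<in> F_ge v \<gamma>"
  using F_ge_add[of x \<gamma> "- y"] F_ge_uminus[of y] by simp

lemma F_ge_scale: "x \<in> F_ge v \<gamma> \<Longrightarrow> scale c x \<in> F_ge v \<gamma>"
  by (cases "c = 0"; cases "x = 0") (auto simp: F_ge_iff v_scale)

lemma F_gt_scale: "x \<in> F_gt v \<gamma> \<Longrightarrow> scale c x \<in> F_gt v \<gamma>"
  by (cases "c = 0"; cases "x = 0") (auto simp: F_gt_iff v_scale)

lemma F_ge_mult: "x \<in> F_ge v \<gamma> \<Longrightarrow> y \<in> F_ge v \<delta> \<Longrightarrow> x * y \<in> F_ge v (\<gamma> + \<delta>)"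
  using v_mult[of x y]
  by (cases "x = 0"; cases "y = 0") (auto simp: F_ge_iff intro: add_mono)

text \<open>One strict factor makes the product strict. Together with \<open>F_gt_mult_right\<close>
  this makes products of classes independent of the representatives.\<close>

lemma F_gt_mult_left: "x \<in> F_gt v \<gamma> \<Longrightarrow> y \<in> F_ge v \<delta> \<Longrightarrow> x * y \<in> F_gt v (\<gamma> + \<delta>)"
  using v_mult[of x y]
  by (cases "x = 0"; cases "y = 0") (auto simp: F_ge_iff F_gt_iff intro: add_less_le_mono)

lemma F_gt_mult_right: "x \<in> F_ge v \<gamma> \<Longrightarrow> y \<in> F_gt v \<delta> \<Longrightarrow> x * y \<in> F_gt v (\<gamma> + \<delta>)"
  using v_mult[of x y]
  by (cases "x = 0"; cases "y = 0") (auto simp: F_ge_iff F_gt_iff intro: add_le_less_mono)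

lemma F_gt_sum: "(\<And>i. i \<in> S \<Longrightarrow> f i \<in> F_gt v \<gamma>) \<Longrightarrow> sum f S \<in> F_gt v \<gamma>"
  by (induction S rule: infinite_finite_induct) (auto simp: F_gt_add, auto simp: F_gt_iff)

lemma F_ge_sum: "(\<And>i. i \<in> S \<Longrightarrow> f i \<in> F_ge v \<gamma>) \<Longrightarrow> sum f S \<in> F_ge v \<gamma>"
  by (induction S rule: infinite_finite_induct) (auto simp: F_ge_add, auto simp: F_ge_iff)

lemma mem_gr_class_iff: "y \<in> gr_class v \<gamma> x \<longleftrightarrow> y - x \<in> F_gt v \<gamma>"
  unfolding gr_class_def image_iff by (metis add.commute diff_add_cancel add_diff_cancel)

lemma gr_class_eq_iff: "gr_class v \<gamma> x = gr_class v \<gamma> y \<longleftrightarrow> x - y \<in> F_gt v \<gamma>"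
proof
  assume "gr_class v \<gamma> x = gr_class v \<gamma> y"
  moreover have "x \<in> gr_class v \<gamma> x" by (simp add: mem_gr_class_iff F_gt_iff)
  ultimately show "x - y \<in> F_gt v \<gamma>" by (simp add: mem_gr_class_iff)
next
  assume xy: "x - y \<in> F_gt v \<gamma>"
  have "z - x \<in> F_gt v \<gamma> \<longleftrightarrow> z - y \<in> F_gt v \<gamma>" for z
    using F_gt_add[OF _ xy, of "z - x"] F_gt_diff[OF _ xy, of "z - y"] by auto
  then show "gr_class v \<gamma> x = gr_class v \<gamma> y" by (auto simp: mem_gr_class_iff)
qed

lemma F_gt_eq_gr_class: "F_gt v \<gamma> = gr_class v \<gamma> 0"
  by (auto simp: mem_gr_class_iff)

text \<open>
  The associated graded algebra is a quotient of the ring of those finitely supported families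
  \<open>p\<close> for which \<open>p \<gamma> \<in> F_ge v \<gamma>\<close>, a subring of the convolution ring \<^typ>\<open>'g \<Rightarrow>\<^sub>0 'b\<close>.
  Its ring laws are inherited from there.
\<close>

definition rees :: "('g \<Rightarrow>\<^sub>0 'b) set" where
  "rees = {p. \<forall>\<gamma>. Poly_Mapping.lookup p \<gamma> \<in> F_ge v \<gamma>}"

text \<open>The quotient map from the Rees algebra of the filtration onto the associated graded
  algebra.\<close>

definition gr_family :: "('g \<Rightarrow>\<^sub>0 'b) \<Rightarrow> 'g \<Rightarrow> 'b set" where
  "gr_family p = (\<lambda>\<gamma>. gr_class v \<gamma> (Poly_Mapping.lookup p \<gamma>))"

lemma mem_gr_family: "x \<in> gr_family p \<gamma> \<longleftrightarrow> x - Poly_Mapping.lookup p \<gamma> \<in> F_gt v \<gamma>"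
  by (simp add: gr_family_def mem_gr_class_iff)

lemma rees_add: "p \<in> rees \<Longrightarrow> q \<in> rees \<Longrightarrow> p + q \<in> rees"
  by (simp add: rees_def lookup_add F_ge_add)

lemma rees_mult:
  assumes "p \<in> rees" "q \<in> rees"
  shows "p * q \<in> rees"
  using assms F_ge_mult[of "Poly_Mapping.lookup p l" l "Poly_Mapping.lookup q (\<gamma> - l)" "\<gamma> - l" for \<gamma> l]
  by (auto simp: rees_def lookup_mult_keys intro!: F_ge_sum)

lemma rees_single: "x \<in> F_ge v \<gamma> \<Longrightarrow> Poly_Mapping.single \<gamma> x \<in> rees"
  by (auto simp: rees_def lookup_single when_def) (simp add: F_ge_iff)

lemma rees_const: "Poly_Mapping.single 0 (scale c 1) \<in> rees"
  by (intro rees_single F_ge_scale) (simp add: F_ge_iff v_one)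

lemma carrier_assoc_graded: "carrier (assoc_graded scale v) = gr_family ` rees"
proof (intro equalityI subsetI)
  fix \<phi> assume \<phi>: "\<phi> \<in> carrier (assoc_graded scale v)"
  then have "\<forall>\<gamma>. \<exists>x\<in>F_ge v \<gamma>. \<phi> \<gamma> = gr_class v \<gamma> x" and fin: "finite {\<gamma>. \<phi> \<gamma> \<noteq> F_gt v \<gamma>}"
    by (auto simp: assoc_graded_def)
  then obtain x where x: "\<And>\<gamma>. x \<gamma> \<in> F_ge v \<gamma>" "\<And>\<gamma>. \<phi> \<gamma> = gr_class v \<gamma> (x \<gamma>)" by metis
  \<comment> \<open>Choosing the representative 0 wherever the class is zero makes the family
    finitely supported.\<close>
  define p where "p = Abs_poly_mapping (\<lambda>\<gamma>. if \<phi> \<gamma> = F_gt v \<gamma> then 0 else x \<gamma>)"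
  have "finite {\<gamma>. (if \<phi> \<gamma> = F_gt v \<gamma> then 0 else x \<gamma>) \<noteq> 0}"
    by (rule finite_subset[OF _ fin]) auto
  then have p: "Poly_Mapping.lookup p \<gamma> = (if \<phi> \<gamma> = F_gt v \<gamma> then 0 else x \<gamma>)" for \<gamma>
    by (simp add: p_def)
  have "\<phi> = gr_family p"
    by (auto simp: fun_eq_iff gr_family_def p F_gt_eq_gr_class x(2))
  moreover have "p \<in> rees"
    using x by (auto simp: rees_def p) (simp add: F_ge_iff)
  ultimately show "\<phi> \<in> gr_family ` rees" by blast
next
  fix \<phi> assume "\<phi> \<in> gr_family ` rees"
  then obtain p where p: "p \<in> rees" "\<phi> = gr_family p" by blast
  have "finite {\<gamma>. \<phi> \<gamma> \<noteq> F_gt v \<gamma>}"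
    by (rule finite_subset[of _ "Poly_Mapping.keys p"])
      (auto simp: p gr_family_def F_gt_eq_gr_class in_keys_iff)
  with p show "\<phi> \<in> carrier (assoc_graded scale v)"
    by (auto simp: assoc_graded_def gr_family_def rees_def)
qed

lemma gr_family_add: "gr_family p \<oplus>\<^bsub>assoc_graded scale v\<^esub> gr_family q = gr_family (p + q)"
proof
  fix \<gamma>
  have "{x + y | x y. x \<in> gr_family p \<gamma> \<and> y \<in> gr_family q \<gamma>} = gr_family (p + q) \<gamma>" (is "?L = ?R")
  proof (intro equalityI subsetI)
    fix z assume "z \<in> ?L"
    then obtain x y where z: "z = x + y" and xy: "x - Poly_Mapping.lookup p \<gamma> \<in> F_gt v \<gamma>"
        "y - Poly_Mapping.lookup q \<gamma> \<in> F_gt v \<gamma>"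
      by (auto simp: mem_gr_family)
    show "z \<in> ?R"
      using F_gt_add[OF xy] by (simp add: z mem_gr_family lookup_add algebra_simps)
  next
    fix z assume "z \<in> ?R"
    then have "Poly_Mapping.lookup p \<gamma> \<in> gr_family p \<gamma>" "z - Poly_Mapping.lookup p \<gamma> \<in> gr_family q \<gamma>"
      by (auto simp: mem_gr_family lookup_add algebra_simps F_gt_iff)
    then show "z \<in> ?L" by force
  qed
  then show "(gr_family p \<oplus>\<^bsub>assoc_graded scale v\<^esub> gr_family q) \<gamma> = gr_family (p + q) \<gamma>"
    by (simp add: assoc_graded_def)
qed

lemma lookup_const_mult: "Poly_Mapping.lookup (Poly_Mapping.single 0 (scale c 1) * p) \<gamma>
    = scale c (Poly_Mapping.lookup p \<gamma>)"
  for p :: "'g \<Rightarrow>\<^sub>0 'b"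
  using scale_conv_mult[of c "Poly_Mapping.lookup p \<gamma>"]
  by (cases "scale c 1 = 0") (simp_all add: lookup_mult_keys)

lemma gr_family_smult:
  "c \<odot>\<^bsub>assoc_graded scale v\<^esub> gr_family p = gr_family (Poly_Mapping.single 0 (scale c 1) * p)"
proof
  fix \<gamma>
  have "{scale c x + z | x z. x \<in> gr_family p \<gamma> \<and> z \<in> F_gt v \<gamma>}
      = gr_family (Poly_Mapping.single 0 (scale c 1) * p) \<gamma>" (is "?L = ?R")
  proof (intro equalityI subsetI)
    fix y assume "y \<in> ?L"
    then obtain x z where y: "y = scale c x + z" and xz: "x - Poly_Mapping.lookup p \<gamma> \<in> F_gt v \<gamma>"
        "z \<in> F_gt v \<gamma>"
      by (auto simp: mem_gr_family)
    have "y - scale c (Poly_Mapping.lookup p \<gamma>) = scale c (x - Poly_Mapping.lookup p \<gamma>) + z"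
      by (simp add: y scale_right_diff_distrib)
    with F_gt_add[OF F_gt_scale[OF xz(1), of c] xz(2)] show "y \<in> ?R"
      by (simp add: mem_gr_family lookup_const_mult)
  next
    fix y assume "y \<in> ?R"
    then have "Poly_Mapping.lookup p \<gamma> \<in> gr_family p \<gamma>"
        "y - scale c (Poly_Mapping.lookup p \<gamma>) \<in> F_gt v \<gamma>"
      by (auto simp: mem_gr_family lookup_const_mult F_gt_iff)
    then show "y \<in> ?L" by force
  qed
  then show "(c \<odot>\<^bsub>assoc_graded scale v\<^esub> gr_family p) \<gamma>
      = gr_family (Poly_Mapping.single 0 (scale c 1) * p) \<gamma>"
    by (simp add: assoc_graded_def)
qed

text \<open>The product in \<open>assoc_graded\<close> differs from the convolution in two ways: it
  sums only over the degrees where the class of \<open>p\<close> is non-zero, and it admits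
  arbitrary representatives. Each changes the component in degree \<open>\<gamma>\<close> only by an
  element of \<open>F_gt v \<gamma>\<close>.\<close>

lemma gr_family_mult:
  assumes p: "p \<in> rees" and q: "q \<in> rees"
  shows "gr_family p \<otimes>\<^bsub>assoc_graded scale v\<^esub> gr_family q = gr_family (p * q)"
proof
  fix \<gamma>
  define S where "S = {\<alpha>. gr_family p \<alpha> \<noteq> F_gt v \<alpha>}"
  have S: "S \<subseteq> Poly_Mapping.keys p"
    by (auto simp: S_def gr_family_def F_gt_eq_gr_class in_keys_iff)
  have lookup_ge: "Poly_Mapping.lookup p \<alpha> \<in> F_ge v \<alpha>" "Poly_Mapping.lookup q \<alpha> \<in> F_ge v \<alpha>" for \<alpha>
    using p q by (auto simp: rees_def)
  \<comment> \<open>The intermediate term of the comparison: the coefficients of \<open>p\<close>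
    and \<open>q\<close>, but summed over the index set \<open>S\<close> of the graded
    product.\<close>
  define r where "r = (\<Sum>\<alpha>\<in>S. Poly_Mapping.lookup p \<alpha> * Poly_Mapping.lookup q (\<gamma> - \<alpha>))"
  have "Poly_Mapping.lookup (p * q) \<gamma> - r
      = (\<Sum>\<alpha>\<in>Poly_Mapping.keys p - S. Poly_Mapping.lookup p \<alpha> * Poly_Mapping.lookup q (\<gamma> - \<alpha>))"
    unfolding r_def lookup_mult_keys by (subst sum_diff) (use S in auto)
  also have "\<dots> \<in> F_gt v \<gamma>"
  proof (rule F_gt_sum)
    fix \<alpha> assume "\<alpha> \<in> Poly_Mapping.keys p - S"
    then have "Poly_Mapping.lookup p \<alpha> \<in> F_gt v \<alpha>"
      by (simp add: S_def gr_family_def F_gt_eq_gr_class[of \<alpha>] gr_class_eq_iff)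
    from F_gt_mult_left[OF this lookup_ge(2)[of "\<gamma> - \<alpha>"]]
    show "Poly_Mapping.lookup p \<alpha> * Poly_Mapping.lookup q (\<gamma> - \<alpha>) \<in> F_gt v \<gamma>" by simp
  qed
  finally have r: "Poly_Mapping.lookup (p * q) \<gamma> - r \<in> F_gt v \<gamma>" .
  have rep: "(\<Sum>\<alpha>\<in>S. f \<alpha> * g (\<gamma> - \<alpha>)) - r \<in> F_gt v \<gamma>"
    if f: "\<forall>\<alpha>. f \<alpha> \<in> gr_family p \<alpha>" and g: "\<forall>\<alpha>. g \<alpha> \<in> gr_family q \<alpha>" for f g
    unfolding r_def sum_subtractf[symmetric]
  proof (rule F_gt_sum)
    fix \<alpha>
    have fd: "f \<alpha> - Poly_Mapping.lookup p \<alpha> \<in> F_gt v \<alpha>" using f by (simp add: mem_gr_family)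
    have gd: "g (\<gamma> - \<alpha>) - Poly_Mapping.lookup q (\<gamma> - \<alpha>) \<in> F_gt v (\<gamma> - \<alpha>)"
      using g by (simp add: mem_gr_family)
    have "g (\<gamma> - \<alpha>) \<in> F_ge v (\<gamma> - \<alpha>)"
      using F_ge_add[OF F_gt_imp_F_ge[OF gd] lookup_ge(2)] by simp
    \<comment> \<open>Telescoping: \<open>f g - p q = (f - p) g + p (g - q)\<close>, with one strict
      factor in each summand.\<close>
    from F_gt_add[OF F_gt_mult_left[OF fd this] F_gt_mult_right[OF lookup_ge(1) gd]]
    show "f \<alpha> * g (\<gamma> - \<alpha>) - Poly_Mapping.lookup p \<alpha> * Poly_Mapping.lookup q (\<gamma> - \<alpha>) \<in> F_gt v \<gamma>"
      by (simp add: algebra_simps)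
  qed
  have "{(\<Sum>\<alpha>\<in>S. f \<alpha> * g (\<gamma> - \<alpha>)) + z | f g z.
      (\<forall>\<alpha>. f \<alpha> \<in> gr_family p \<alpha>) \<and> (\<forall>\<alpha>. g \<alpha> \<in> gr_family q \<alpha>) \<and> z \<in> F_gt v \<gamma>}
      = gr_family (p * q) \<gamma>" (is "?L = ?R")
  proof (intro equalityI subsetI)
    fix x assume "x \<in> ?L"
    then obtain f g z where x: "x = (\<Sum>\<alpha>\<in>S. f \<alpha> * g (\<gamma> - \<alpha>)) + z"
      and "\<forall>\<alpha>. f \<alpha> \<in> gr_family p \<alpha>" "\<forall>\<alpha>. g \<alpha> \<in> gr_family q \<alpha>" and z: "z \<in> F_gt v \<gamma>"
      by blast
    from F_gt_add[OF F_gt_diff[OF rep[OF this(2,3)] r] z]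
    show "x \<in> ?R" by (simp add: mem_gr_family x algebra_simps)
  next
    fix x assume "x \<in> ?R"
    with r have "x - r \<in> F_gt v \<gamma>"
      using F_gt_add[of "x - Poly_Mapping.lookup (p * q) \<gamma>" \<gamma> "Poly_Mapping.lookup (p * q) \<gamma> - r"]
      by (simp add: mem_gr_family)
    moreover have "Poly_Mapping.lookup p \<alpha> \<in> gr_family p \<alpha>" "Poly_Mapping.lookup q \<alpha> \<in> gr_family q \<alpha>" for \<alpha>
      by (simp_all add: mem_gr_family F_gt_iff)
    \<comment> \<open>With \<open>p\<close> and \<open>q\<close> as their own representatives,
      \<open>x - r\<close> serves as the free summand \<open>z\<close>.\<close>
    moreover have "x = r + (x - r)" by simp
    ultimately show "x \<in> ?L" unfolding r_def by blast
  qed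
  then show "(gr_family p \<otimes>\<^bsub>assoc_graded scale v\<^esub> gr_family q) \<gamma> = gr_family (p * q) \<gamma>"
    by (simp add: assoc_graded_def S_def)
qed

lemma assoc_graded_one: "\<one>\<^bsub>assoc_graded scale v\<^esub> = gr_family (Poly_Mapping.single 0 1)"
  by (auto simp: assoc_graded_def gr_family_def lookup_one when_def fun_eq_iff)

lemma initial_form_eq: "initial_form v f = gr_family (Poly_Mapping.single (v f) f)"
  by (auto simp: initial_form_def gr_family_def lookup_single when_def fun_eq_iff)

sublocale gr: prealgebra "assoc_graded scale v"
proof
  fix \<phi> \<psi> \<chi> c
  let ?R = "assoc_graded scale v" and ?c = "Poly_Mapping.single 0 (scale c 1) :: 'g \<Rightarrow>\<^sub>0 'b"
  assume "\<phi> \<in> carrier ?R"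
  then obtain p where p: "p \<in> rees" "\<phi> = gr_family p" by (auto simp: carrier_assoc_graded)
  show "c \<odot>\<^bsub>?R\<^esub> \<phi> \<in> carrier ?R"
    using p by (simp add: carrier_assoc_graded gr_family_smult rees_mult rees_const)
  assume "\<psi> \<in> carrier ?R"
  then obtain q where q: "q \<in> rees" "\<psi> = gr_family q" by (auto simp: carrier_assoc_graded)
  show "\<phi> \<oplus>\<^bsub>?R\<^esub> \<psi> \<in> carrier ?R" "\<phi> \<otimes>\<^bsub>?R\<^esub> \<psi> \<in> carrier ?R"
    using p q by (simp_all add: carrier_assoc_graded gr_family_add gr_family_mult rees_add rees_mult)
  show "(c \<odot>\<^bsub>?R\<^esub> \<phi>) \<otimes>\<^bsub>?R\<^esub> \<psi> = c \<odot>\<^bsub>?R\<^esub> (\<phi> \<otimes>\<^bsub>?R\<^esub> \<psi>)"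
      "\<phi> \<otimes>\<^bsub>?R\<^esub> (c \<odot>\<^bsub>?R\<^esub> \<psi>) = c \<odot>\<^bsub>?R\<^esub> (\<phi> \<otimes>\<^bsub>?R\<^esub> \<psi>)"
    using p q by (simp_all add: gr_family_smult gr_family_mult rees_mult rees_const mult.assoc mult.left_commute)
  assume "\<chi> \<in> carrier ?R"
  then obtain r where r: "r \<in> rees" "\<chi> = gr_family r" by (auto simp: carrier_assoc_graded)
  show "(\<phi> \<oplus>\<^bsub>?R\<^esub> \<psi>) \<otimes>\<^bsub>?R\<^esub> \<chi> = \<phi> \<otimes>\<^bsub>?R\<^esub> \<chi> \<oplus>\<^bsub>?R\<^esub> \<psi> \<otimes>\<^bsub>?R\<^esub> \<chi>"
      "\<phi> \<otimes>\<^bsub>?R\<^esub> (\<psi> \<oplus>\<^bsub>?R\<^esub> \<chi>) = \<phi> \<otimes>\<^bsub>?R\<^esub> \<psi> \<oplus>\<^bsub>?R\<^esub> \<phi> \<otimes>\<^bsub>?R\<^esub> \<chi>"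
    using p q r by (simp_all add: gr_family_add gr_family_mult rees_add distrib_left distrib_right)
qed

end

section \<open>Evaluation of polynomials in a type algebra\<close>

definition monomial_eval :: "('x \<Rightarrow> 'b::comm_ring_1) \<Rightarrow> ('x \<Rightarrow>\<^sub>0 nat) \<Rightarrow> 'b" where
  "monomial_eval a m = (\<Prod>i\<in>Poly_Mapping.keys m. a i ^ Poly_Mapping.lookup m i)"

lemma type_algebra_simps:
  "carrier (type_algebra scale) = UNIV" "x \<oplus>\<^bsub>type_algebra scale\<^esub> y = x + y"
  "x \<otimes>\<^bsub>type_algebra scale\<^esub> y = x * y" "c \<odot>\<^bsub>type_algebra scale\<^esub> x = scale c x"
  "\<zero>\<^bsub>type_algebra scale\<^esub> = 0" "\<one>\<^bsub>type_algebra scale\<^esub> = 1"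
  by (simp_all add: type_algebra_def)

lemma cring_type_algebra: "cring (type_algebra scale)"
proof (rule cringI)
  show "abelian_group (type_algebra scale)"
  proof (rule abelian_groupI)
    show "\<exists>y\<in>carrier (type_algebra scale). y \<oplus>\<^bsub>type_algebra scale\<^esub> x = \<zero>\<^bsub>type_algebra scale\<^esub>" for x
      by (rule bexI[of _ "- x"]) (simp_all add: type_algebra_simps)
  qed (simp_all add: type_algebra_simps algebra_simps)
  show "Group.comm_monoid (type_algebra scale)"
    by (rule comm_monoidI) (auto simp: type_algebra_simps algebra_simps)
qed (simp add: type_algebra_simps algebra_simps)

lemma finsum_type_algebra: "finite S \<Longrightarrow> finsum (type_algebra scale) f S = sum f S"
proof -
  interpret cring "type_algebra scale" by (rule cring_type_algebra)
  show "finite S \<Longrightarrow> ?thesis"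
    by (induction S rule: finite_induct) (simp_all add: type_algebra_simps)
qed

lemma finprod_type_algebra: "finite S \<Longrightarrow> finprod (type_algebra scale) f S = prod f S"
proof -
  interpret cring "type_algebra scale" by (rule cring_type_algebra)
  show "finite S \<Longrightarrow> ?thesis"
    by (induction S rule: finite_induct) (simp_all add: type_algebra_simps)
qed

lemma nat_pow_type_algebra: "x [^]\<^bsub>type_algebra scale\<^esub> (n::nat) = x ^ n"
proof -
  interpret cring "type_algebra scale" by (rule cring_type_algebra)
  show ?thesis
    by (induction n) (simp_all add: type_algebra_simps)
qed

lemma eval_term_type_algebra:
  "eval_term (type_algebra scale) a h m = scale (Poly_Mapping.lookup h m) (monomial_eval a m)"
  by (simp add: eval_term_def type_algebra_simps finprod_type_algebra nat_pow_type_algebra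
      monomial_eval_def)

lemma eval_poly_type_algebra:
  "eval_poly (type_algebra scale) a h
    = (\<Sum>m\<in>Poly_Mapping.keys h. scale (Poly_Mapping.lookup h m) (monomial_eval a m))"
  by (simp add: eval_poly_def finsum_type_algebra eval_term_type_algebra)

lemma monomial_eval_superset:
  assumes "finite S" "Poly_Mapping.keys m \<subseteq> S"
  shows "monomial_eval a m = (\<Prod>i\<in>S. a i ^ Poly_Mapping.lookup m i)"
  unfolding monomial_eval_def
  by (rule prod.mono_neutral_left) (use assms in \<open>auto simp: in_keys_iff\<close>)

lemma monomial_eval_zero [simp]: "monomial_eval a 0 = 1"
  by (simp add: monomial_eval_def)

lemma monomial_eval_add: "monomial_eval a (m + n) = monomial_eval a m * monomial_eval a n"
proof -
  let ?S = "Poly_Mapping.keys m \<union> Poly_Mapping.keys n"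
  have "monomial_eval a (m + n) = (\<Prod>i\<in>?S. a i ^ Poly_Mapping.lookup (m + n) i)"
    by (rule monomial_eval_superset) (use keys_add[of m n] in auto)
  moreover have "monomial_eval a m = (\<Prod>i\<in>?S. a i ^ Poly_Mapping.lookup m i)"
      "monomial_eval a n = (\<Prod>i\<in>?S. a i ^ Poly_Mapping.lookup n i)"
    by (rule monomial_eval_superset; simp)+
  ultimately show ?thesis
    by (simp add: lookup_add power_add prod.distrib)
qed

lemma monomial_eval_sum: "monomial_eval a (sum m S) = (\<Prod>i\<in>S. monomial_eval a (m i))"
  by (induction S rule: infinite_finite_induct) (simp_all add: monomial_eval_add)

lemma monomial_eval_single [simp]: "monomial_eval a (Poly_Mapping.single i k) = a i ^ k"
  by (cases "k = 0") (simp_all add: monomial_eval_def)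

text \<open>Only multiplicative closure of \<open>W\<close> is assumed, so that \<open>W\<close> can
  be a set of non-zero homogeneous elements, which is not closed under addition.\<close>

lemma monomial_eval_closed:
  fixes a :: "'x \<Rightarrow> 'b::comm_ring_1"
  assumes one: "1 \<in> W" and mult: "\<And>x y. x \<in> W \<Longrightarrow> y \<in> W \<Longrightarrow> x * y \<in> W"
    and a: "\<And>i. i \<in> Poly_Mapping.keys m \<Longrightarrow> a i \<in> W"
  shows "monomial_eval a m \<in> W"
proof -
  have "x ^ n \<in> W" if "x \<in> W" for x and n :: nat
    by (induction n) (simp_all add: one mult that)
  moreover have "prod f S \<in> W" if "\<And>i. i \<in> S \<Longrightarrow> f i \<in> W" for f and S :: "'x set"
    using that by (induction S rule: infinite_finite_induct) (simp_all add: one mult)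
  ultimately show ?thesis using a by (simp add: monomial_eval_def)
qed

context K_algebra
begin

lemma eval_poly_add:
  "eval_poly (type_algebra scale) a (h + h')
    = eval_poly (type_algebra scale) a h + eval_poly (type_algebra scale) a h'"
  unfolding eval_poly_type_algebra
  by (rule setsum_keys_plus_distrib) (auto simp: scale_left_distrib)

lemma eval_poly_zero [simp]: "eval_poly (type_algebra scale) a 0 = 0"
  by (simp add: eval_poly_type_algebra)

lemma eval_poly_sum:
  "eval_poly (type_algebra scale) a (sum h S) = (\<Sum>i\<in>S. eval_poly (type_algebra scale) a (h i))"
  by (induction S rule: infinite_finite_induct) (simp_all add: eval_poly_add)

lemma eval_poly_single:
  "eval_poly (type_algebra scale) a (Poly_Mapping.single m c) = scale c (monomial_eval a m)"
  by (cases "c = 0") (simp_all add: eval_poly_type_algebra)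

end

lemma indets_add: "indets (h + h') \<subseteq> indets h \<union> indets h'"
  using keys_add[of h h'] by (auto simp: indets_def)

lemma keys_sum_subset: "Poly_Mapping.keys (sum f S) \<subseteq> (\<Union>i\<in>S. Poly_Mapping.keys (f i))"
proof
  fix x assume "x \<in> Poly_Mapping.keys (sum f S)"
  then have "(\<Sum>i\<in>S. Poly_Mapping.lookup (f i) x) \<noteq> 0" by (simp add: in_keys_iff lookup_sum)
  then obtain i where "i \<in> S" "Poly_Mapping.lookup (f i) x \<noteq> 0"
    by (rule sum.not_neutral_contains_not_neutral)
  then show "x \<in> (\<Union>i\<in>S. Poly_Mapping.keys (f i))" by (auto simp: in_keys_iff)
qed

section \<open>Valuations on a graded subalgebra\<close>

locale graded_valued_algebra = valued_algebra scale v
  for scale :: "'k::field \<Rightarrow> 'b::idom \<Rightarrow> 'b" and v :: "'b \<Rightarrow> 'g::linordered_ab_group_add" +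
  fixes A :: "'b set" and D :: "'d::ab_group_add \<Rightarrow> 'b set"
  assumes subalgebra: "subalg (type_algebra scale) A"
    and graded: "graded_by scale A D"
begin

lemma one_in_A: "1 \<in> A"
  using subalgebra by (simp add: subalg_def type_algebra_simps)

lemma D_subspace: "subspace (D \<delta>)" and D_subset: "D \<delta> \<subseteq> A"
  and D_mult: "f \<in> D \<delta> \<Longrightarrow> g \<in> D \<epsilon> \<Longrightarrow> f * g \<in> D (\<delta> + \<epsilon>)"
  using graded by (auto simp: graded_by_def)

definition total :: "('d \<Rightarrow>\<^sub>0 'b) \<Rightarrow> 'b" where
  "total c = (\<Sum>\<delta>\<in>Poly_Mapping.keys c. Poly_Mapping.lookup c \<delta>)"

lemma decompose:
  assumes "a \<in> A"
  obtains c where "\<And>\<delta>. Poly_Mapping.lookup c \<delta> \<in> D \<delta>" "total c = a"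
  using graded assms unfolding graded_by_def total_def by blast

lemma decomposition_unique:
  assumes "a \<in> A" "\<And>\<delta>. Poly_Mapping.lookup c \<delta> \<in> D \<delta>" "total c = a"
    "\<And>\<delta>. Poly_Mapping.lookup c' \<delta> \<in> D \<delta>" "total c' = a"
  shows "c = c'"
proof -
  have "\<exists>!c. (\<forall>\<delta>. Poly_Mapping.lookup c \<delta> \<in> D \<delta>) \<and> total c = a"
    using graded assms(1) unfolding graded_by_def total_def by blast
  with assms(2-) show ?thesis by blast
qed

lemma total_single [simp]: "total (Poly_Mapping.single \<delta> x) = x"
  by (cases "x = 0") (simp_all add: total_def)

lemma total_zero [simp]: "total 0 = 0"
  by (simp add: total_def)

lemma total_add: "total (c + c') = total c + total c'"
  unfolding total_def by (rule setsum_keys_plus_distrib) auto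

lemma total_sum: "total (sum c S) = (\<Sum>i\<in>S. total (c i))"
  by (induction S rule: infinite_finite_induct) (simp_all add: total_add)

lemma lookup_single_in_D: "x \<in> D \<delta> \<Longrightarrow> Poly_Mapping.lookup (Poly_Mapping.single \<delta> x) \<epsilon> \<in> D \<epsilon>"
  by (auto simp: lookup_single when_def subspace_0 D_subspace)

text \<open>Placing \<open>x\<close> in degree \<open>\<delta>\<close> or in degree
  \<open>\<epsilon>\<close> gives two homogeneous decompositions of the same element, which must
  agree.\<close>

lemma degree_unique:
  assumes "x \<in> D \<delta>" "x \<in> D \<epsilon>" "x \<noteq> 0"
  shows "\<delta> = \<epsilon>"
proof -
  have "Poly_Mapping.single \<delta> x = Poly_Mapping.single \<epsilon> x"
    by (rule decomposition_unique[of x]) (use assms D_subset lookup_single_in_D in auto)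
  then have "Poly_Mapping.lookup (Poly_Mapping.single \<epsilon> x) \<delta> = x" by (metis lookup_single_eq)
  with assms(3) show ?thesis by (auto simp: lookup_single when_def split: if_splits)
qed

lemma deg_eq: "x \<in> D \<delta> \<Longrightarrow> x \<noteq> 0 \<Longrightarrow> deg D x = \<delta>"
  unfolding deg_def by (rule the_equality) (auto dest: degree_unique)

text \<open>Collecting the summands by degree gives a homogeneous decomposition of \<open>f\<close>,
  and so does \<open>f\<close> alone in degree \<open>\<delta>\<close>. By uniqueness the two have
  the same component in degree \<open>\<delta>\<close>; the summands of other degrees cancel among
  themselves.\<close>

lemma homogeneous_component:
  assumes f: "f \<in> D \<delta>" "f = (\<Sum>i\<in>S. t i)" and S: "finite S" and t: "\<And>i. i \<in> S \<Longrightarrow> t i \<in> D (d i)"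
  shows "f = (\<Sum>i\<in>{i\<in>S. d i = \<delta>}. t i)"
proof -
  let ?c = "\<Sum>i\<in>S. Poly_Mapping.single (d i) (t i)"
  have "?c = Poly_Mapping.single \<delta> f"
  proof (rule decomposition_unique[of f])
    show "Poly_Mapping.lookup ?c \<epsilon> \<in> D \<epsilon>" for \<epsilon>
      unfolding lookup_sum using t by (intro subspace_sum[OF D_subspace] lookup_single_in_D)
  qed (use f D_subset lookup_single_in_D in \<open>auto simp: total_sum\<close>)
  from arg_cong[OF this, of "\<lambda>c. Poly_Mapping.lookup c \<delta>"]
  have "f = (\<Sum>i\<in>S. if d i = \<delta> then t i else 0)"
    by (simp add: lookup_sum lookup_single when_def)
  then show ?thesis by (simp add: sum.inter_filter[OF S])
qed

text \<open>
  Since \<open>B\<close> is a domain, it suffices that multiplication by the degree \<open>0\<close> part of \<open>1\<close> fixes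
  a single non-zero homogeneous element.
\<close>

lemma one_in_D: "1 \<in> D 0"
proof -
  obtain c where c: "\<And>\<delta>. Poly_Mapping.lookup c \<delta> \<in> D \<delta>" "total c = 1"
    using decompose[OF one_in_A] by blast
  then have "c \<noteq> 0" by auto
  then obtain \<epsilon> where "\<epsilon> \<in> Poly_Mapping.keys c" by (metis all_not_in_conv keys_eq_empty)
  moreover define x where "x = Poly_Mapping.lookup c \<epsilon>"
  ultimately have x: "x \<noteq> 0" "x \<in> D \<epsilon>" using c by (auto simp: in_keys_iff)
  let ?c = "\<Sum>\<delta>\<in>Poly_Mapping.keys c. Poly_Mapping.lookup c \<delta> * x"
  have "?c = x" using c(2) by (simp add: total_def sum_distrib_right[symmetric])
  then have "x = (\<Sum>\<delta>\<in>{\<delta>\<in>Poly_Mapping.keys c. \<delta> + \<epsilon> = \<epsilon>}. Poly_Mapping.lookup c \<delta> * x)"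
    using x c(1) by (intro homogeneous_component) (auto intro: D_mult)
  also have "\<dots> = (\<Sum>\<delta>\<in>{0}. Poly_Mapping.lookup c \<delta> * x)"
    by (rule sum.mono_neutral_left) (auto simp: in_keys_iff)
  finally have "Poly_Mapping.lookup c 0 = 1" using x(1) by simp
  with c(1)[of 0] show ?thesis by simp
qed

text \<open>The multiplicative set on which \<open>deg\<close> and \<open>v\<close> are both
  meaningful and additive. Zero is excluded because it lies in every \<open>D \<delta>\<close> and
  \<open>v 0\<close> is arbitrary.\<close>

definition hom_nonzero :: "'b set" where
  "hom_nonzero = {x. x \<noteq> 0 \<and> homogeneous D x}"

lemma hom_nonzeroE:
  assumes "x \<in> hom_nonzero"
  obtains \<delta> where "x \<in> D \<delta>" "x \<noteq> 0" "deg D x = \<delta>"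
  using assms deg_eq by (auto simp: hom_nonzero_def homogeneous_def)

lemma hom_nonzero_one: "1 \<in> hom_nonzero"
  using one_in_D by (auto simp: hom_nonzero_def homogeneous_def)

lemma hom_nonzero_mult: "x \<in> hom_nonzero \<Longrightarrow> y \<in> hom_nonzero \<Longrightarrow> x * y \<in> hom_nonzero"
  unfolding hom_nonzero_def homogeneous_def using D_mult by fastforce

lemma hom_nonzero_scale: "c \<noteq> 0 \<Longrightarrow> x \<in> hom_nonzero \<Longrightarrow> scale c x \<in> hom_nonzero"
  using subspace_scale[OF D_subspace] by (auto simp: hom_nonzero_def homogeneous_def)

lemma deg_one: "deg D 1 = 0"
  by (simp add: deg_eq one_in_D)

lemma deg_mult: "x \<in> hom_nonzero \<Longrightarrow> y \<in> hom_nonzero \<Longrightarrow> deg D (x * y) = deg D x + deg D y"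
  by (elim hom_nonzeroE) (simp add: deg_eq D_mult)

lemma deg_scale: "c \<noteq> 0 \<Longrightarrow> x \<in> hom_nonzero \<Longrightarrow> deg D (scale c x) = deg D x"
  by (elim hom_nonzeroE) (simp add: deg_eq subspace_scale[OF D_subspace])

section \<open>Initial forms in the tensor product\<close>

sublocale ten: tensor_factors "assoc_graded scale v"
    "group_ring :: ('k, 'd \<Rightarrow>\<^sub>0 'k) module" ..

abbreviation gr_ten :: "('k, ((('g \<Rightarrow> 'b set) \<times> ('d \<Rightarrow>\<^sub>0 'k)) \<Rightarrow>\<^sub>0 'k) set) module" where
  "gr_ten \<equiv> gr_tensor scale v"

text \<open>Separates the element from its degrees. \<open>in_hom\<close> reads both degrees off its
  argument, whereas here they stay fixed, so that elements of larger value, and 0, also have a class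
  in degree \<open>(\<gamma>, \<delta>)\<close>.\<close>

definition graded_class :: "'g \<Rightarrow> 'd \<Rightarrow> 'b \<Rightarrow> ((('g \<Rightarrow> 'b set) \<times> ('d \<Rightarrow>\<^sub>0 'k)) \<Rightarrow>\<^sub>0 'k) set" where
  "graded_class \<gamma> \<delta> x = pure_tensor (assoc_graded scale v) group_ring
     (gr_family (Poly_Mapping.single \<gamma> x)) (Poly_Mapping.single \<delta> 1)"

lemma in_hom_eq: "in_hom scale v D f = graded_class (v f) (deg D f) f"
  by (simp add: in_hom_def graded_class_def initial_form_eq)

lemma single_in_carrier:
  "x \<in> F_ge v \<gamma> \<Longrightarrow> gr_family (Poly_Mapping.single \<gamma> x) \<in> carrier (assoc_graded scale v)"
  by (simp add: carrier_assoc_graded rees_single)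

lemma group_ring_simps:
  "carrier (group_ring :: ('k, 'd \<Rightarrow>\<^sub>0 'k) module) = UNIV"
  "x \<otimes>\<^bsub>(group_ring :: ('k, 'd \<Rightarrow>\<^sub>0 'k) module)\<^esub> y = x * y"
  "\<one>\<^bsub>(group_ring :: ('k, 'd \<Rightarrow>\<^sub>0 'k) module)\<^esub> = 1"
  by (simp_all add: group_ring_def type_algebra_simps)

lemma graded_class_add:
  assumes "x \<in> F_ge v \<gamma>" "y \<in> F_ge v \<gamma>"
  shows "graded_class \<gamma> \<delta> x \<oplus>\<^bsub>gr_ten\<^esub> graded_class \<gamma> \<delta> y = graded_class \<gamma> \<delta> (x + y)"
  using assms unfolding graded_class_def gr_tensor_def
  by (subst ten.pure_tensor_add_left)
    (simp_all add: single_in_carrier group_ring_simps gr_family_add single_add)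

lemma graded_class_mult:
  assumes "x \<in> F_ge v \<gamma>" "y \<in> F_ge v \<gamma>'"
  shows "graded_class \<gamma> \<delta> x \<otimes>\<^bsub>gr_ten\<^esub> graded_class \<gamma>' \<delta>' y = graded_class (\<gamma> + \<gamma>') (\<delta> + \<delta>') (x * y)"
  using assms unfolding graded_class_def gr_tensor_def
  by (subst ten.pure_tensor_mult)
    (simp_all add: single_in_carrier group_ring_simps gr_family_mult rees_single mult_single)

lemma graded_class_smult:
  assumes "x \<in> F_ge v \<gamma>"
  shows "c \<odot>\<^bsub>gr_ten\<^esub> graded_class \<gamma> \<delta> x = graded_class \<gamma> \<delta> (scale c x)"
  using assms scale_conv_mult[of c x] unfolding graded_class_def gr_tensor_def
  by (subst ten.pure_tensor_smult_left)
    (simp_all add: single_in_carrier group_ring_simps gr_family_smult mult_single)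

lemma graded_class_cong:
  assumes "x - y \<in> F_gt v \<gamma>"
  shows "graded_class \<gamma> \<delta> x = graded_class \<gamma> \<delta> y"
proof -
  have "gr_family (Poly_Mapping.single \<gamma> x) = gr_family (Poly_Mapping.single \<gamma> y)"
    using assms by (auto simp: gr_family_def fun_eq_iff lookup_single when_def gr_class_eq_iff F_gt_iff)
  then show ?thesis by (simp add: graded_class_def)
qed

lemma one_gr_ten: "\<one>\<^bsub>gr_ten\<^esub> = graded_class 0 0 1"
  unfolding graded_class_def gr_tensor_def ten.T_one assoc_graded_one group_ring_simps by simp

text \<open>\<open>subalg\<close> mentions the unit and scalars but not the zero element; writing
  the zero class as a scalar multiple of the unit places it in every subalgebra.\<close>

lemma graded_class_zero: "graded_class \<gamma> \<delta> 0 = 0 \<odot>\<^bsub>gr_ten\<^esub> \<one>\<^bsub>gr_ten\<^esub>"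
proof -
  have "graded_class \<gamma> \<delta> 0 = 0 \<odot>\<^bsub>gr_ten\<^esub> graded_class \<gamma> \<delta> 0"
    using graded_class_smult[of 0 \<gamma> 0 \<delta>] by (simp add: F_ge_iff)
  also have "\<dots> = 0 \<odot>\<^bsub>gr_ten\<^esub> graded_class 0 0 1"
    unfolding graded_class_def gr_tensor_def by (rule ten.pure_tensor_smult_zero)
  finally show ?thesis by (simp add: one_gr_ten)
qed

lemma in_hom_one: "in_hom scale v D 1 = \<one>\<^bsub>gr_ten\<^esub>"
  by (simp add: in_hom_eq one_gr_ten v_one deg_one)

lemma in_hom_mult:
  assumes "x \<in> hom_nonzero" "y \<in> hom_nonzero"
  shows "in_hom scale v D (x * y) = in_hom scale v D x \<otimes>\<^bsub>gr_ten\<^esub> in_hom scale v D y"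
  using assms unfolding in_hom_eq
  by (subst graded_class_mult) (simp_all add: F_ge_iff deg_mult, simp add: hom_nonzero_def v_mult)

lemma in_hom_scale:
  assumes "c \<noteq> 0" "x \<in> hom_nonzero"
  shows "in_hom scale v D (scale c x) = c \<odot>\<^bsub>gr_ten\<^esub> in_hom scale v D x"
  using assms unfolding in_hom_eq
  by (subst graded_class_smult) (simp_all add: F_ge_iff deg_scale, simp add: hom_nonzero_def v_scale)

section \<open>Faithful representations and initial forms\<close>

lemma val_ext_le_iff: "f \<noteq> 0 \<Longrightarrow> val_ext v f \<le> val_ext v x \<longleftrightarrow> x \<in> F_ge v (v f)"
  by (auto simp: val_ext_def F_ge_iff)

text \<open>Lets a bound on the value of a term be read as a bound on its monomial.\<close>

lemma F_ge_scale_iff: "c \<noteq> 0 \<Longrightarrow> scale c x \<in> F_ge v \<gamma> \<longleftrightarrow> x \<in> F_ge v \<gamma>"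
  by (cases "x = 0") (auto simp: F_ge_iff v_scale)

text \<open>Stated for an arbitrary subalgebra \<open>T\<close>, since the generated subalgebra is a
  \<open>hull\<close>, that is, the intersection of all such \<open>T\<close>.\<close>

lemma in_hom_in_subalg:
  assumes T: "subalg gr_ten T" "in_hom scale v D ` set gs \<subseteq> T"
    and gs: "set gs \<subseteq> hom_nonzero" and f: "f \<in> hom_nonzero"
    and rep: "faithfully_representable scale [v] gs f"
  shows "in_hom scale v D f \<in> T"
proof -
  obtain h :: "(nat, 'k) mpoly" where h: "indets h \<subseteq> {..<length gs}"
      "eval_poly (type_algebra scale) ((!) gs) h = f"
      "\<And>m. m \<in> Poly_Mapping.keys h
        \<Longrightarrow> val_ext v (eval_term (type_algebra scale) ((!) gs) h m) \<ge> val_ext v f"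
    using rep by (auto simp: faithfully_representable_def)
  define t where "t m = eval_term (type_algebra scale) ((!) gs) h m" for m
  \<comment> \<open>A multiplicative set containing the entries of \<open>gs\<close>, hence all
    their monomials.\<close>
  let ?W = "{x \<in> hom_nonzero. in_hom scale v D x \<in> T}"
  have T_closed: "\<one>\<^bsub>gr_ten\<^esub> \<in> T" "\<And>x y. x \<in> T \<Longrightarrow> y \<in> T \<Longrightarrow> x \<oplus>\<^bsub>gr_ten\<^esub> y \<in> T"
      "\<And>x y. x \<in> T \<Longrightarrow> y \<in> T \<Longrightarrow> x \<otimes>\<^bsub>gr_ten\<^esub> y \<in> T" "\<And>c x. x \<in> T \<Longrightarrow> c \<odot>\<^bsub>gr_ten\<^esub> x \<in> T"
    using T(1) by (auto simp: subalg_def)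
  have W: "t m \<in> ?W" if m: "m \<in> Poly_Mapping.keys h" for m
  proof -
    have "monomial_eval ((!) gs) m \<in> ?W"
    proof (rule monomial_eval_closed)
      fix i assume "i \<in> Poly_Mapping.keys m"
      with m h(1) have "gs ! i \<in> set gs" by (auto simp: indets_def)
      with gs T(2) show "gs ! i \<in> ?W" by auto
    qed (auto simp: hom_nonzero_one hom_nonzero_mult in_hom_one in_hom_mult T_closed)
    moreover have "Poly_Mapping.lookup h m \<noteq> 0" using m by (simp add: in_keys_iff)
    ultimately show ?thesis
      by (simp add: t_def eval_term_type_algebra hom_nonzero_scale in_hom_scale T_closed)
  qed
  define \<gamma> \<delta> where "\<gamma> = v f" and "\<delta> = deg D f"
  have t_ge: "t m \<in> F_ge v \<gamma>" if "m \<in> Poly_Mapping.keys h" for m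
    using h(3)[OF that] f by (simp add: hom_nonzero_def val_ext_le_iff \<gamma>_def t_def)
  let ?M = "{m \<in> Poly_Mapping.keys h. deg D (t m) = \<delta>}"
  have f_sum: "f = (\<Sum>m\<in>?M. t m)"
  proof (rule homogeneous_component)
    show "f \<in> D \<delta>" using f by (auto simp: \<delta>_def elim: hom_nonzeroE)
    show "f = (\<Sum>m\<in>Poly_Mapping.keys h. t m)"
      unfolding h(2)[symmetric] t_def by (simp add: eval_poly_type_algebra eval_term_type_algebra)
    show "t m \<in> D (deg D (t m))" if "m \<in> Poly_Mapping.keys h" for m
      using W[OF that] by (auto elim: hom_nonzeroE)
  qed simp
  have zero: "graded_class \<gamma> \<delta> 0 \<in> T"
    by (simp add: graded_class_zero T_closed)
  have t_class: "graded_class \<gamma> \<delta> (t m) \<in> T" if m: "m \<in> ?M" for m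
  proof (cases "v (t m) = \<gamma>")
    case True
    then show ?thesis using W[of m] m by (simp add: in_hom_eq)
  next
    \<comment> \<open>A term of value above \<open>\<gamma>\<close> contributes the zero class in
      degree \<open>\<gamma>\<close>.\<close>
    case False
    then have "t m - 0 \<in> F_gt v \<gamma>" using t_ge[of m] m by (auto simp: F_ge_iff F_gt_iff)
    from graded_class_cong[OF this, of \<delta>] zero show ?thesis by simp
  qed
  \<comment> \<open>Partial sums may vanish or have value above \<open>\<gamma>\<close>, so their
    own initial forms are unsuitable for the induction; their classes in the fixed degree
    \<open>(\<gamma>, \<delta>)\<close> add up.\<close>
  have "graded_class \<gamma> \<delta> (sum t N) \<in> T" if "finite N" "N \<subseteq> ?M" for N
    using that
  proof (induction N rule: finite_induct)
    case empty
    then show ?case by (simp add: zero)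
  next
    case (insert m N)
    then have "graded_class \<gamma> \<delta> (t m) \<oplus>\<^bsub>gr_ten\<^esub> graded_class \<gamma> \<delta> (sum t N) \<in> T"
      by (intro T_closed t_class) auto
    moreover have "sum t N \<in> F_ge v \<gamma>" using insert.prems by (intro F_ge_sum t_ge) auto
    moreover have "t m \<in> F_ge v \<gamma>" using insert.prems by (intro t_ge) auto
    ultimately show ?case using insert.hyps by (simp add: graded_class_add)
  qed
  from this[of ?M] show ?thesis
    by (simp add: f_sum[symmetric] in_hom_eq \<gamma>_def[symmetric] \<delta>_def[symmetric])
qed

lemma in_hom_alg_homogeneous:
  assumes "\<forall>g\<in>G. homogeneous D g" "0 \<notin> G"
  shows "in_hom_alg scale v D G = generated_subalg gr_ten (in_hom scale v D ` G)"
proof -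
  have "{in_hom scale v D f | f. f \<in> G \<and> f \<noteq> 0 \<and> homogeneous D f} = in_hom scale v D ` G"
    using assms by auto
  then show ?thesis by (simp add: in_hom_alg_def)
qed

theorem MUVAK_imp_Khovanskii:
  assumes muvak: "MUVAK_basis scale A D [v] G" and G: "0 \<notin> G"
  shows "Khovanskii_basis scale A D v G"
proof -
  have gen: "homogeneous_generators scale A D G" using muvak by (simp add: MUVAK_basis_def)
  then have G_hom: "G \<subseteq> A" "G \<subseteq> hom_nonzero"
    using G by (auto simp: homogeneous_generators_def hom_nonzero_def)
  have "generated_subalg gr_ten (in_hom scale v D ` G) \<subseteq> in_hom_alg scale v D A"
    unfolding in_hom_alg_def generated_subalg_def
    using G_hom by (intro hull_mono) (auto simp: hom_nonzero_def)
  moreover have "in_hom_alg scale v D A \<subseteq> generated_subalg gr_ten (in_hom scale v D ` G)"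
    unfolding generated_subalg_def
  proof
    fix x assume x: "x \<in> in_hom_alg scale v D A"
    show "x \<in> subalg gr_ten hull (in_hom scale v D ` G)"
      unfolding hull_def
    proof (intro InterI, clarify)
      fix T assume T: "subalg gr_ten T" "in_hom scale v D ` G \<subseteq> T"
      have "in_hom scale v D f \<in> T" if f: "f \<in> A" "f \<noteq> 0" "homogeneous D f" for f
      proof -
        obtain gs where gs: "set gs \<subseteq> G" "faithfully_representable scale [v] gs f"
          using muvak f by (auto simp: MUVAK_basis_def)
        show ?thesis
          by (rule in_hom_in_subalg[OF T(1) _ _ _ gs(2)])
            (use T gs f G_hom in \<open>auto simp: hom_nonzero_def\<close>)
      qed
      then have "in_hom_alg scale v D A \<subseteq> T"
        unfolding in_hom_alg_def generated_subalg_def by (intro hull_minimal) (use T in auto)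
      with x show "x \<in> T" by blast
    qed
  qed
  ultimately show ?thesis
    using gen G by (simp add: Khovanskii_basis_def)
qed

section \<open>Subduction yields faithful representations\<close>

text \<open>Bridges two conventions: the algorithm uses the generators themselves as indeterminates,
  while faithful representability uses positions in a list.\<close>

lemma faithfully_representable_of_set:
  fixes h :: "('b, 'k) mpoly"
  assumes f: "f \<noteq> 0" and h: "indets h \<subseteq> set gs" "eval_poly (type_algebra scale) (\<lambda>g. g) h = f"
    and ge: "\<And>m. m \<in> Poly_Mapping.keys h \<Longrightarrow> monomial_eval (\<lambda>g. g) m \<in> F_ge v (v f)"
  shows "faithfully_representable scale [v] gs f"
proof -
  \<comment> \<open>One position is fixed for each generator, as the list may contain
    repetitions.\<close>
  define idx where "idx g = (SOME i. i < length gs \<and> gs ! i = g)" for g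
  have idx: "idx g < length gs" "gs ! idx g = g" if "g \<in> set gs" for g
  proof -
    have "\<exists>i. i < length gs \<and> gs ! i = g" using that by (auto simp: in_set_conv_nth)
    from someI_ex[OF this] show "idx g < length gs" "gs ! idx g = g" by (simp_all add: idx_def)
  qed
  define ren where
    "ren m = (\<Sum>g\<in>Poly_Mapping.keys m. Poly_Mapping.single (idx g) (Poly_Mapping.lookup m g))"
    for m :: "'b \<Rightarrow>\<^sub>0 nat"
  define h' where "h' = (\<Sum>m\<in>Poly_Mapping.keys h. Poly_Mapping.single (ren m) (Poly_Mapping.lookup h m))"
  have keys_in: "Poly_Mapping.keys m \<subseteq> set gs" if "m \<in> Poly_Mapping.keys h" for m
    using h(1) that by (auto simp: indets_def)
  have ren: "monomial_eval ((!) gs) (ren m) = monomial_eval (\<lambda>g. g) m"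
    if "m \<in> Poly_Mapping.keys h" for m
    unfolding ren_def monomial_eval_sum monomial_eval_single monomial_eval_def[of "\<lambda>g. g"]
    using keys_in[OF that] by (intro prod.cong) (auto simp: idx)
  have keys_h': "Poly_Mapping.keys h' \<subseteq> ren ` Poly_Mapping.keys h"
    unfolding h'_def using keys_sum_subset by (fastforce split: if_splits)
  have "Poly_Mapping.keys (ren m) \<subseteq> {..<length gs}" if "m \<in> Poly_Mapping.keys h" for m
  proof -
    have "Poly_Mapping.keys (ren m) \<subseteq> idx ` Poly_Mapping.keys m"
      unfolding ren_def using keys_sum_subset by (fastforce split: if_splits)
    moreover have "idx ` Poly_Mapping.keys m \<subseteq> {..<length gs}"
      using keys_in[OF that] idx(1) by (auto simp: subset_iff)
    ultimately show ?thesis by (rule subset_trans)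
  qed
  with keys_h' have "indets h' \<subseteq> {..<length gs}"
    unfolding indets_def by blast
  moreover have "eval_poly (type_algebra scale) ((!) gs) h' = f"
    unfolding h'_def eval_poly_sum eval_poly_single using h(2)
    by (simp add: ren eval_poly_type_algebra)
  moreover have "val_ext v (eval_term (type_algebra scale) ((!) gs) h' m) \<ge> val_ext v f"
    if m: "m \<in> Poly_Mapping.keys h'" for m
  proof -
    obtain n where "n \<in> Poly_Mapping.keys h" "m = ren n" using m keys_h' by blast
    \<comment> \<open>The bound concerns monomials without coefficients, so it passes along
      \<open>ren\<close> to \<open>h'\<close> whatever its coefficients are.\<close>
    then have "monomial_eval ((!) gs) m \<in> F_ge v (v f)" using ge by (simp add: ren)
    then show ?thesis using f by (simp add: val_ext_le_iff eval_term_type_algebra F_ge_scale)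
  qed
  ultimately show ?thesis
    by (auto simp: faithfully_representable_def)
qed

lemma subduction_invariant:
  fixes rule :: "('b, 'k) choice_rule"
  assumes rule: "valid_rule scale A D v rule" and G: "G \<subseteq> A" "G \<subseteq> hom_nonzero"
    and f: "f \<in> D \<delta>" "f \<noteq> 0" and result: "subduction scale D v rule G f = Some (G', h, r)"
  shows "r \<in> D \<delta>" "eval_poly (type_algebra scale) (\<lambda>g. g) h + r = f" "indets h \<subseteq> G"
    "\<forall>m\<in>Poly_Mapping.keys h. monomial_eval (\<lambda>g. g) m \<in> F_ge v (v f)"
    "\<not> subduction_continues scale D v G r"
proof -
  let ?ev = "eval_poly (type_algebra scale) (\<lambda>g. g)"
  define Inv :: "('b, 'k) subduction_state \<Rightarrow> bool" where
    \<comment> \<open>The values of monomials are bounded, not those of terms: every monomial of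
      \<open>h + h'\<close> occurs in \<open>h\<close> or \<open>h'\<close>, while the coefficients
      may change. The bound on \<open>r\<close> keeps later steps comparable with
      \<open>v f\<close>.\<close>
    "Inv = (\<lambda>(G', h, r). r \<in> D \<delta> \<and> r \<in> F_ge v (v f) \<and> ?ev h + r = f \<and> indets h \<subseteq> G
      \<and> (\<forall>m\<in>Poly_Mapping.keys h. monomial_eval (\<lambda>g. g) m \<in> F_ge v (v f)))"
  have step: "Inv (G' \<union> F, h + h', r - ?ev h')"
    if inv: "Inv (G', h, r)" and cont: "subduction_continues scale D v G r"
      and choice: "rule G (G', h, r) = (F, h')" for G' h r F h'
  proof -
    have r: "r \<noteq> 0" "r \<in> D \<delta>" "r \<in> F_ge v (v f)"
      using inv cont by (auto simp: Inv_def subduction_continues_def)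
    have "G \<subseteq> A - {0}" "\<forall>g\<in>G. homogeneous D g" "r \<in> A" "homogeneous D r"
      using r(2) D_subset G by (auto simp: homogeneous_def hom_nonzero_def)
    then have "admissible_choice scale D v G r F h'"
      using rule cont choice unfolding valid_rule_def by blast
    then have h': "indets h' \<subseteq> G" "\<And>m. m \<in> Poly_Mapping.keys h'
        \<Longrightarrow> scale (Poly_Mapping.lookup h' m) (monomial_eval (\<lambda>g. g) m) \<in> F_ge v (v r)"
        "\<And>m. m \<in> Poly_Mapping.keys h'
        \<Longrightarrow> deg D (scale (Poly_Mapping.lookup h' m) (monomial_eval (\<lambda>g. g) m)) = \<delta>"
      using r by (auto simp: admissible_choice_def val_ext_le_iff eval_term_type_algebra deg_eq)
    have le: "F_ge v (v r) \<subseteq> F_ge v (v f)"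
      using r by (auto simp: F_ge_iff)
    \<comment> \<open>The rule controls only \<open>deg\<close>, which determines the component of a
      non-zero homogeneous element. The terms are such elements because the generators are and
      \<open>B\<close> is a domain.\<close>
    have "scale (Poly_Mapping.lookup h' m) (monomial_eval (\<lambda>g. g) m) \<in> D \<delta>"
      if m: "m \<in> Poly_Mapping.keys h'" for m
    proof -
      have "monomial_eval (\<lambda>g. g) m \<in> hom_nonzero"
        using m h'(1) G(2) by (intro monomial_eval_closed hom_nonzero_one hom_nonzero_mult)
          (auto simp: indets_def)
      then have "scale (Poly_Mapping.lookup h' m) (monomial_eval (\<lambda>g. g) m) \<in> hom_nonzero"
        using m by (intro hom_nonzero_scale) (auto simp: in_keys_iff)
      with h'(3)[OF m] show ?thesis by (auto elim: hom_nonzeroE)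
    qed
    then have "?ev h' \<in> D \<delta>"
      unfolding eval_poly_type_algebra by (intro subspace_sum[OF D_subspace])
    then have "r - ?ev h' \<in> D \<delta>" using r by (intro subspace_diff[OF D_subspace])
    moreover have "?ev h' \<in> F_ge v (v f)"
      unfolding eval_poly_type_algebra using h'(2) le by (intro F_ge_sum) auto
    then have "r - ?ev h' \<in> F_ge v (v f)" using r by (intro F_ge_diff)
    moreover have "monomial_eval (\<lambda>g. g) m \<in> F_ge v (v f)" if "m \<in> Poly_Mapping.keys h'" for m
      using h'(2)[OF that] that le by (auto simp: F_ge_scale_iff in_keys_iff)
    ultimately show ?thesis
      using inv h'(1) indets_add[of h h'] keys_add[of h h']
      by (auto simp: Inv_def eval_poly_add)
  qed
  have "Inv (G', h, r)"
    using _ result[unfolded subduction_def]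
  proof (rule while_option_rule)
    show "Inv ({}, 0, f)"
      using f by (simp add: Inv_def F_ge_iff indets_def)
  qed (auto split: prod.splits intro!: step)
  then show "r \<in> D \<delta>" "?ev h + r = f" "indets h \<subseteq> G"
    "\<forall>m\<in>Poly_Mapping.keys h. monomial_eval (\<lambda>g. g) m \<in> F_ge v (v f)"
    by (auto simp: Inv_def)
  show "\<not> subduction_continues scale D v G r"
    using while_option_stop[OF result[unfolded subduction_def]] by simp
qed

theorem Khovanskii_imp_MUVAK:
  fixes rule :: "('b, 'k) choice_rule"
  assumes rule: "valid_rule scale A D v rule" "subduction_terminates scale A D v rule"
    and khov: "Khovanskii_basis scale A D v (set gs)" and gs: "0 \<notin> set gs"
  shows "MUVAK_basis scale A D [v] (set gs)"
proof -
  have gen: "homogeneous_generators scale A D (set gs)"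
    using khov by (simp add: Khovanskii_basis_def)
  then have G: "set gs \<subseteq> A" "set gs \<subseteq> hom_nonzero" "\<forall>g\<in>set gs. homogeneous D g"
    using gs by (auto simp: homogeneous_generators_def hom_nonzero_def)
  \<comment> \<open>The Khovanskii property enters here: the algebra tested by the loop condition is
    the full initial algebra of \<open>A\<close>.\<close>
  have alg: "in_hom_alg scale v D (set gs) = in_hom_alg scale v D A"
    using khov gs in_hom_alg_homogeneous[OF G(3) gs] by (simp add: Khovanskii_basis_def)
  have "faithfully_representable scale [v] gs f" if f: "f \<in> A" "homogeneous D f" for f
  proof (cases "f = 0")
    case True
    then show ?thesis
      \<comment> \<open>As \<open>v(0)\<close> is infinite, the zero polynomial is chosen: it has no
        terms on which the bound could fail.\<close>
      unfolding faithfully_representable_def by (intro exI[of _ 0]) (simp add: indets_def)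
  next
    case False
    obtain \<delta> where \<delta>: "f \<in> D \<delta>" using f by (auto simp: homogeneous_def)
    have "subduction scale D v rule (set gs) f \<noteq> None"
      using rule(2) f G gs unfolding subduction_terminates_def by blast
    then obtain G' h r where "subduction scale D v rule (set gs) f = Some (G', h, r)" by auto
    note inv = subduction_invariant[OF rule(1) G(1,2) \<delta> False this]
    \<comment> \<open>A non-zero remainder is a homogeneous element of \<open>A\<close>, so its
      initial form is one of the generators of the initial algebra of \<open>A\<close> and the loop
      would have continued.\<close>
    have "r = 0"
    proof (rule ccontr)
      assume "r \<noteq> 0"
      moreover have "r \<in> A" "homogeneous D r" using inv(1) D_subset by (auto simp: homogeneous_def)
      ultimately have "in_hom scale v D r \<in> in_hom_alg scale v D A"
        unfolding in_hom_alg_def generated_subalg_def by (intro hull_inc) blast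
      with inv(5) \<open>r \<noteq> 0\<close> alg show False by (simp add: subduction_continues_def)
    qed
    with inv False show ?thesis
      by (intro faithfully_representable_of_set[of f h]) auto
  qed
  then show ?thesis
    using gen by (auto simp: MUVAK_basis_def)
qed

end

theorem theorem3p6:
  fixes scale :: "'k::field \<Rightarrow> 'b::idom \<Rightarrow> 'b"
    and A :: "'b set"
    and D :: "'d::ab_group_add \<Rightarrow> 'b set"
    and v :: "'b \<Rightarrow> 'g::linordered_ab_group_add"
    and fs :: "'b list"
  assumes "K_algebra scale"
    and "finitely_generated_alg (type_algebra scale) (UNIV :: 'b set)"
    and "subalg (type_algebra scale) A"
    and "finitely_generated_alg (type_algebra scale) A"
    and "\<exists>S :: 'd set. finite S \<and> group_closure S = UNIV"
    and "graded_by scale A D"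
    and "valuation_over scale v"
    and "0 \<notin> set fs"
    and "homogeneous_generators scale A D (set fs)"
  shows "(MUVAK_basis scale A D [v] (set fs) \<longrightarrow> Khovanskii_basis scale A D v (set fs))
    \<and> (\<forall>rule. valid_rule scale A D v rule \<and> subduction_terminates scale A D v rule
          \<and> Khovanskii_basis scale A D v (set fs)
          \<longrightarrow> MUVAK_basis scale A D [v] (set fs))"
proof -
  interpret K_algebra scale by fact
  interpret graded_valued_algebra scale v A D
    by standard (use assms in auto)
  show ?thesis
    using MUVAK_imp_Khovanskii Khovanskii_imp_MUVAK assms(8) by blast
qed

end
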